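(* Consider a coherent control system, with set of admissible controls $\mathbf{C}$, collection of control times $\mathbf{G}$ and Bellman system $V$, and suppose that the deterministic times $0$ and $\infty$ belong to $\mathbf{G}$. Suppose first that the weak upwards lattice property holds. Then: (B1) $(V(c,\mathcal S))_{(c,\mathcal S)\in \mathbf{C}\times\mathbf{G}}$ is a $(\mathbf{C},\mathbf{G})$-supermartingale system. (B2) If $c^*\in\mathbf{C}$ is optimal, then $(V(c^*,\mathcal T))_{\mathcal T\in\mathbf{G}}$ has a constant $\mathsf P^{c^*}$-expectation (equal to the optimal value $v=\mathsf E^{\mathsf P^{c^*}}J(c^* )$). (B3) If $c^*\in\mathbf{C}$ is optimal and $\mathsf E^{\mathsf P^{c^*}}J(c^* )<\infty$, then $(V(c^*,\mathcal T))_{\mathcal T\in\mathbf{G}}$ is a $\mathbf{G}$-martingale in the sense that (i) for each $\mathcal T\in\mathbf{G}$, $V(c^*,\mathcal T)$ is $\mathcal G^{c^*}_{\mathcal T^{c^*}}$-measurable and $\mathsf P^{c^*}$-integrable, and (ii) for any $\mathcal S,\mathcal T\in\mathbf{G}$ with $\mathcal S^d\le\mathcal T^d$ \{$\mathsf P^d$-a.s.\} for all $d\in\mathcal D(c^*,\mathcal T)$, $$\mathsf E^{\mathsf P^{c^*}}[V(c^*,\mathcal T)\mid\mathcal G^{c^*}_{\mathcal S^{c^*}}]=V(c^*,\mathcal S)\quad \mathsf P^{c^*}\text{-a.s.}$$ (B4) If $c^*\in\mathbf{C}$ is conditionally optimal at $\mathcal S\in\mathbf{G}$ and $\mathsf E^{\mathsf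 P^{c^*}}J(c^* )<\infty$, then $c^*$ is conditionally optimal at $\mathcal T$ for any $\mathcal T\in\mathbf{G}$ satisfying $\mathcal T^d\ge\mathcal S^d$ \{$\mathsf P^d$-a.s.\} for all $d\in\mathcal D(c^*,\mathcal T)$. In particular, if $c^*$ is optimal, then it is conditionally optimal at $0$, so that if also $\mathsf E^{\mathsf P^{c^*}}J(c^* )<\infty$, then $c^*$ is conditionally optimal at every $\mathcal S\in\mathbf{G}$. Moreover, regardless of whether or not the weak upwards lattice property holds: (B5) If $c^*\in\mathbf{C}$ and $\mathbf{G}$ includes a sequence $(\mathcal S_n)_{n\in\mathbb N_0}$ for which (i) $\mathcal S_0=0$, (ii) the family $(V(c^*,\mathcal S_n))_{n\ge0}$ has a constant $\mathsf P^{c^*}$-expectation and is uniformly integrable (under $\mathsf P^{c^*}$), and (iii) $V(c^*,\mathcal S_n)\to V(c^*,\infty)$ $\mathsf P^{c^*}$-a.s. (or even just in $\mathsf P^{c^*}$-probability) as $n\to\infty$, then $c^*$ is optimal.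
   Context: Two parallel settings are treated: the "measure-theoretic" setting, in which all text in braces \{...\} is ignored, and the "completed" setting, in which the text in braces is included. The result is asserted in each of the two settings. A stochastic control system consists of: (i) a time set $T$, which is either $\mathbb N_0$ or $[0,\infty)$; (ii) a set $\mathbf{C}$ of admissible controls (an arbitrary set); (iii) a sample space $\Omega$ with a collection of $\sigma$-algebras $(\mathcal F^c)_{c\in\mathbf{C}}$; (iv) \{complete\} probability measures $(\mathsf P^c)_{c\in\mathbf{C}}$, the domain of $\mathsf P^c$ including the \{$\mathsf P^c$-complete\} $\sigma$-field $\mathcal F^c$; (v) a reward function $J:\mathbf{C}\to[-\infty,\infty]^\Omega$, each $J(c)$ being $\mathcal F^c$-measurable \{and defined up to $\mathsf P^c$-a.s. equality\}, with $\mathsf E^{\mathsf P^c}J(c)^-<\infty$ for all $c\in\mathbf{C}$; (vi) filtrations $(\mathcal G^c)_{c\in\mathbf{C}}$ on $\Omega$ indexed by $T$, such that $\mathcal G^c_\infty:=\bigvee_{t\in T}\mathcal G^c_t\subset\mathcal F^c$, $\mathcal G^c_0$ is $\mathsf P^c$-trivial \{and contains all the $\mathsf P^c$-null sets\}, and $\mathcal G^c_0=\mathcal G^d_0$ \{so the null sets of $\mathsf P^c$ and $\mathsf P^d$ are the same\} and $\mathsf P^c|_{\mathcal G^c_0}=\mathsf P^d|_{\mathcal G^d_0}$ for all $c,d\in\mathbf{C}$. A control time is a collection $\mathcal S=(\mathcal S^c)_{c\in\mathbf{C}}$ such that, for every $c$, $\mathcal S^c:\Omega\to T\cup\{\infty\}$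 is a \{defined up to $\mathsf P^c$-a.s. equality\} stopping time of $\mathcal G^c$. For $a\in T\cup\{\infty\}$, the deterministic time $a$ is the control time with $\mathcal S^c=a$ \{$\mathsf P^c$-a.s.\} for all $c$. For a stopping time $S$ of a filtration $\mathcal G$, $\mathcal G_S:=\{A\in\mathcal G_\infty: A\cap\{S\le t\}\in\mathcal G_t\ \forall t\in T\}$. The system has adaptive control dynamics if it comes with a collection $\mathbf{G}$ of control times and a family $(\mathcal D(c,\mathcal S))_{(c,\mathcal S)\in\mathbf{C}\times\mathbf{G}}$ of subsets of $\mathbf{C}$ such that: (1) $c\in\mathcal D(c,\mathcal S)$ for all $(c,\mathcal S)$; (2) $d\in\mathcal D(c,\mathcal S)$ implies $\mathcal S^c=\mathcal S^d$ \{$\mathsf P^c$- and $\mathsf P^d$-a.s.\}; (3) if $\mathcal S,\mathcal T\in\mathbf{G}$, $c\in\mathbf{C}$ and $\mathcal S^c=\mathcal T^c$ \{$\mathsf P^c$-a.s.\}, then $\mathcal D(c,\mathcal S)=\mathcal D(c,\mathcal T)$; (4) if $\mathcal S,\mathcal T\in\mathbf{G}$ and $c\in\mathbf{C}$ are such that $\mathcal S^d\le\mathcal T^d$ \{$\mathsf P^d$-a.s.\} for all $d\in\mathcal D(c,\mathcal T)$, then $\mathcal D(c,\mathcal T)\subset\mathcal D(c,\mathcal S)$; (5) for each $\mathcal S\in\mathbf{G}$, $\{\mathcal D(c,\mathcal S):c\in\mathbf{C}\}$ is a partition of $\mathbf{C}$; (6) if $\mathcal S^c$ is identically \{or $\mathsf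 P^c$-a.s.\} equal to $\infty$ (resp. $0$), then $\mathcal D(c,\mathcal S)=\{c\}$ (resp. $\mathcal D(c,\mathcal S)=\mathbf{C}$). Write $c\sim_{\mathcal S}d$ if $c,d$ lie in the same member of this partition. The system is stable under stopping if $c\sim_{\mathcal S}d$ implies $\mathcal G^c_{\mathcal S^c}=\mathcal G^d_{\mathcal S^d}$ and $\mathsf P^c|_{\mathcal G^c_{\mathcal S^c}}=\mathsf P^d|_{\mathcal G^d_{\mathcal S^d}}$. A coherent control system is a stochastic control system with adaptive control dynamics which is stable under stopping. Conditional payoff system: $J(c,\mathcal S):=\mathsf E^{\mathsf P^c}[J(c)\mid\mathcal G^c_{\mathcal S^c}]$. Bellman system: $V(c,\mathcal S):=\mathsf P^c|_{\mathcal G^c_{\mathcal S^c}}\text{-}\mathrm{esssup}_{d\in\mathcal D(c,\mathcal S)}J(d,\mathcal S)$. A control $c$ is conditionally optimal at $\mathcal S\in\mathbf{G}$ if $V(c,\mathcal S)=J(c,\mathcal S)$ $\mathsf P^c$-a.s. The optimal value is $v:=\sup_{c\in\mathbf{C}}\mathsf E^{\mathsf P^c}J(c)$, and $c$ is optimal if $\mathsf E^{\mathsf P^c}J(c)=v$. Weak upwards lattice property: for every $c\in\mathbf{C}$, $\mathcal S\in\mathbf{G}$ and $\epsilon,M\in(0,\infty)$, whenever $d,d'\in\mathcal D(c,\mathcal S)$ there is $d''\in\mathcal D(c,\mathcal S)$ with $J(d'',\mathcal S)\ge(M\wedge J(d,\mathcal S))\vee(M\wedge J(d',\mathcal S))-\epsilon$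 $\mathsf P^c$-a.s. A collection $X=(X(c,\mathcal S))_{(c,\mathcal S)\in\mathbf{C}\times\mathbf{G}}$ of functions in $[-\infty,\infty]^\Omega$ is a $(\mathbf{C},\mathbf{G})$-supermartingale system if for each $(c,\mathcal S)$: (i) $X(c,\mathcal S)$ is $\mathcal G^c_{\mathcal S^c}$-measurable; (ii) $X(c,\mathcal S)=X(d,\mathcal S)$ $\mathsf P^c$-a.s. and $\mathsf P^d$-a.s. whenever $c\sim_{\mathcal S}d$; (iii) the negative part of $X(c,\mathcal S)$ is $\mathsf P^c$-integrable; (iv) for all $\mathcal S,\mathcal T\in\mathbf{G}$ and $c\in\mathbf{C}$ with $\mathcal S^d\le\mathcal T^d$ \{$\mathsf P^d$-a.s.\} for all $d\in\mathcal D(c,\mathcal T)$, $\mathsf E^{\mathsf P^c}[X(c,\mathcal T)\mid\mathcal G^c_{\mathcal S^c}]\le X(c,\mathcal S)$ $\mathsf P^c$-a.s. *)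

theory Defs
  imports "HOL-Probability.Probability"
begin

section \<open>Extended-real-valued random variables\<close>

text \<open>
  The library's expectations and conditional expectations are for real and for \<open>ennreal\<close>-valued
  functions. For \<open>ereal\<close>-valued functions we take the difference of the positive and the negative
  part, in the same way as the library defines \<^const>\<open>real_cond_exp\<close> from \<^const>\<open>nn_cond_exp\<close>
  (\<^const>\<open>e2ennreal\<close> truncates negative values to \<open>0\<close>). They have their usual meaning as soon as the
  negative part has finite expectation.
\<close>

definition neg_integral :: "'w measure \<Rightarrow> ('w \<Rightarrow> ereal) \<Rightarrow> ennreal" where
  "neg_integral M f = (\<integral>\<^sup>+ x. e2ennreal (- f x) \<partial>M)"

definition ereal_expectation :: "'w measure \<Rightarrow> ('w \<Rightarrow> ereal) \<Rightarrow> ereal" where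
  "ereal_expectation M f =
     enn2ereal (\<integral>\<^sup>+ x. e2ennreal (f x) \<partial>M) - enn2ereal (neg_integral M f)"

definition ereal_cond_exp :: "'w measure \<Rightarrow> 'w measure \<Rightarrow> ('w \<Rightarrow> ereal) \<Rightarrow> 'w \<Rightarrow> ereal" where
  "ereal_cond_exp M F f = (\<lambda>x.
     enn2ereal (nn_cond_exp M F (\<lambda>x. e2ennreal (f x)) x)
     - enn2ereal (nn_cond_exp M F (\<lambda>x. e2ennreal (- f x)) x))"

definition ereal_integrable :: "'w measure \<Rightarrow> ('w \<Rightarrow> ereal) \<Rightarrow> bool" where
  "ereal_integrable M f \<longleftrightarrow> f \<in> borel_measurable M \<and> (\<integral>\<^sup>+ x. e2ennreal \<bar>f x\<bar> \<partial>M) < \<infinity>"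

definition uniformly_integrable :: "'w measure \<Rightarrow> 'i set \<Rightarrow> ('i \<Rightarrow> 'w \<Rightarrow> ereal) \<Rightarrow> bool" where
  "uniformly_integrable M I X \<longleftrightarrow>
     (\<forall>i\<in>I. X i \<in> borel_measurable M) \<and>
     ((\<lambda>K::real. SUP i\<in>I. \<integral>\<^sup>+ x. e2ennreal \<bar>X i x\<bar> * indicator {x. ereal K \<le> \<bar>X i x\<bar>} x \<partial>M)
        \<longlongrightarrow> 0) at_top"

text \<open>
  The conjunct \<open>X n x \<noteq> Y x\<close> only matters where both values are the same infinity, since
  \<open>\<infinity> - \<infinity> = \<infinity>\<close> on \<open>ereal\<close>: two equal values count as being close.
\<close>

definition converges_in_probability ::
  "'w measure \<Rightarrow> (nat \<Rightarrow> 'w \<Rightarrow> ereal) \<Rightarrow> ('w \<Rightarrow> ereal) \<Rightarrow> bool" where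
  "converges_in_probability M X Y \<longleftrightarrow>
     (\<forall>\<epsilon>>0::real.
        (\<lambda>n. measure M {x \<in> space M. X n x \<noteq> Y x \<and> ereal \<epsilon> < \<bar>X n x - Y x\<bar>}) \<longlonglongrightarrow> 0)"

text \<open>
  The essential supremum of a family, unique up to a.e. equality. (The library's \<open>esssup\<close> is the
  essential supremum of the values of a single function.)
\<close>

definition is_esssup :: "'w measure \<Rightarrow> 'i set \<Rightarrow> ('i \<Rightarrow> 'w \<Rightarrow> ereal) \<Rightarrow> ('w \<Rightarrow> ereal) \<Rightarrow> bool" where
  "is_esssup M I X Y \<longleftrightarrow>
     Y \<in> borel_measurable M \<and>
     (\<forall>i\<in>I. AE x in M. X i x \<le> Y x) \<and>
     (\<forall>Z\<in>borel_measurable M. (\<forall>i\<in>I. AE x in M. X i x \<le> Z x) \<longrightarrow> (AE x in M. Y x \<le> Z x))"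


section \<open>Control systems\<close>

text \<open>
  \<open>completed\<close> selects one of the two parallel settings: \<open>False\<close> for the measure-theoretic one,
  \<open>True\<close> for the completed one. Objects that in the completed setting are only defined up to
  a.s. equality are given by representatives.

  Time points and the values of control times live in \<open>ennreal\<close>. The \<open>\<sigma>\<close>-fields \<open>events c\<close> and
  \<open>info c t\<close> are represented by measure spaces of which only the measurable sets matter, as is
  done for sub-\<open>\<sigma>\<close>-algebras and filtrations in the library.
  All functions matter only for controls in \<open>controls\<close>, times in \<open>time_set\<close> and sample points
  in \<open>sample_space\<close>.
\<close>

record ('c, 'w) control_system =
  completed :: bool
  time_set :: "ennreal set"
  controls :: "'c set"
  sample_space :: "'w set"
  events :: "'c \<Rightarrow> 'w measure"
  law :: "'c \<Rightarrow> 'w measure"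
  reward :: "'c \<Rightarrow> 'w \<Rightarrow> ereal"
  info :: "'c \<Rightarrow> ennreal \<Rightarrow> 'w measure"
  control_times :: "('c \<Rightarrow> 'w \<Rightarrow> ennreal) set"
  reach :: "'c \<Rightarrow> ('c \<Rightarrow> 'w \<Rightarrow> ennreal) \<Rightarrow> 'c set"  \<comment> \<open>\<open>reach c S\<close> is \<open>\<D>(c, S)\<close>\<close>

text \<open>
  For assertions that carry a braced ``a.s.'': they hold everywhere in the
  measure-theoretic setting and almost surely in the completed one.
\<close>

definition surely :: "('c, 'w) control_system \<Rightarrow> 'c \<Rightarrow> ('w \<Rightarrow> bool) \<Rightarrow> bool" where
  "surely X c Q \<longleftrightarrow>
     (if completed X then AE \<omega> in law X c. Q \<omega> else \<forall>\<omega>\<in>sample_space X. Q \<omega>)"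

definition stochastic_control_system :: "('c, 'w) control_system \<Rightarrow> bool" where
  "stochastic_control_system X \<longleftrightarrow>
     (time_set X = range of_nat \<or> time_set X = {t. t < \<infinity>}) \<and>
     (\<forall>c\<in>controls X.
        prob_space (law X c) \<and> space (law X c) = sample_space X \<and>
        subalgebra (law X c) (events X c) \<and>
        (completed X \<longrightarrow>
           complete_measure (law X c) \<and> null_sets (law X c) \<subseteq> sets (events X c)) \<and>
        reward X c \<in> borel_measurable (events X c) \<and>
        neg_integral (law X c) (reward X c) < \<infinity> \<and>
        (\<forall>t\<in>time_set X. subalgebra (events X c) (info X c t)) \<and>
        (\<forall>s\<in>time_set X. \<forall>t\<in>time_set X. s \<le> t \<longrightarrow> sets (info X c s) \<subseteq> sets (info X c t)) \<and>
        (\<forall>A\<in>sets (info X c 0). measure (law X c) A = 0 \<or> measure (law X c) A = 1) \<and>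
        (completed X \<longrightarrow> null_sets (law X c) \<subseteq> sets (info X c 0))) \<and>
     (\<forall>c\<in>controls X. \<forall>d\<in>controls X.
        sets (info X c 0) = sets (info X d 0) \<and>
        restr_to_subalg (law X c) (info X c 0) = restr_to_subalg (law X d) (info X d 0))"

definition info_infinity :: "('c, 'w) control_system \<Rightarrow> 'c \<Rightarrow> 'w measure" where
  "info_infinity X c = sigma (sample_space X) (\<Union>t\<in>time_set X. sets (info X c t))"

definition control_time :: "('c, 'w) control_system \<Rightarrow> ('c \<Rightarrow> 'w \<Rightarrow> ennreal) \<Rightarrow> bool" where
  "control_time X S \<longleftrightarrow>
     (\<forall>c\<in>controls X.
        (\<forall>\<omega>\<in>sample_space X. S c \<omega> \<in> insert \<infinity> (time_set X)) \<and>
        (\<forall>t\<in>time_set X. {\<omega> \<in> sample_space X. S c \<omega> \<le> t} \<in> sets (info X c t)))"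

definition deterministic_time ::
  "('c, 'w) control_system \<Rightarrow> ennreal \<Rightarrow> ('c \<Rightarrow> 'w \<Rightarrow> ennreal) \<Rightarrow> bool" where
  "deterministic_time X a S \<longleftrightarrow> (\<forall>c\<in>controls X. surely X c (\<lambda>\<omega>. S c \<omega> = a))"

definition info_at :: "('c, 'w) control_system \<Rightarrow> 'c \<Rightarrow> ('c \<Rightarrow> 'w \<Rightarrow> ennreal) \<Rightarrow> 'w measure" where
  "info_at X c S =
     sigma (sample_space X)
       {A \<in> sets (info_infinity X c). \<forall>t\<in>time_set X. {\<omega>\<in>A. S c \<omega> \<le> t} \<in> sets (info X c t)}"

definition law_at :: "('c, 'w) control_system \<Rightarrow> 'c \<Rightarrow> ('c \<Rightarrow> 'w \<Rightarrow> ennreal) \<Rightarrow> 'w measure" where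
  "law_at X c S = restr_to_subalg (law X c) (info_at X c S)"

text \<open>\<open>\<S>\<^sup>d \<le> \<T>\<^sup>d\<close> for all \<open>d \<in> \<D>(c, \<T>)\<close>\<close>

definition precedes ::
  "('c, 'w) control_system \<Rightarrow> 'c \<Rightarrow> ('c \<Rightarrow> 'w \<Rightarrow> ennreal) \<Rightarrow> ('c \<Rightarrow> 'w \<Rightarrow> ennreal) \<Rightarrow> bool" where
  "precedes X c S T \<longleftrightarrow> (\<forall>d\<in>reach X c T. surely X d (\<lambda>\<omega>. S d \<omega> \<le> T d \<omega>))"

definition adaptive_control_dynamics :: "('c, 'w) control_system \<Rightarrow> bool" where
  "adaptive_control_dynamics X \<longleftrightarrow>
     (\<forall>S\<in>control_times X. control_time X S) \<and>
     (\<forall>c\<in>controls X. \<forall>S\<in>control_times X. reach X c S \<subseteq> controls X) \<and>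
     (\<forall>c\<in>controls X. \<forall>S\<in>control_times X. c \<in> reach X c S) \<and>
     (\<forall>c\<in>controls X. \<forall>S\<in>control_times X. \<forall>d\<in>reach X c S.
        surely X c (\<lambda>\<omega>. S c \<omega> = S d \<omega>) \<and> surely X d (\<lambda>\<omega>. S c \<omega> = S d \<omega>)) \<and>
     (\<forall>S\<in>control_times X. \<forall>T\<in>control_times X. \<forall>c\<in>controls X.
        surely X c (\<lambda>\<omega>. S c \<omega> = T c \<omega>) \<longrightarrow> reach X c S = reach X c T) \<and>
     (\<forall>S\<in>control_times X. \<forall>T\<in>control_times X. \<forall>c\<in>controls X.
        precedes X c S T \<longrightarrow> reach X c T \<subseteq> reach X c S) \<and>
     (\<forall>S\<in>control_times X. partition_on (controls X) ((\<lambda>c. reach X c S) ` controls X)) \<and>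
     (\<forall>c\<in>controls X. \<forall>S\<in>control_times X.
        (surely X c (\<lambda>\<omega>. S c \<omega> = \<infinity>) \<longrightarrow> reach X c S = {c}) \<and>
        (surely X c (\<lambda>\<omega>. S c \<omega> = 0) \<longrightarrow> reach X c S = controls X))"

definition equiv_at :: "('c, 'w) control_system \<Rightarrow> ('c \<Rightarrow> 'w \<Rightarrow> ennreal) \<Rightarrow> 'c \<Rightarrow> 'c \<Rightarrow> bool" where
  "equiv_at X S c d \<longleftrightarrow> (\<exists>D \<in> (\<lambda>e. reach X e S) ` controls X. c \<in> D \<and> d \<in> D)"

definition stable_under_stopping :: "('c, 'w) control_system \<Rightarrow> bool" where
  "stable_under_stopping X \<longleftrightarrow>
     (\<forall>S\<in>control_times X. \<forall>c\<in>controls X. \<forall>d\<in>controls X. equiv_at X S c d \<longrightarrow>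
        sets (info_at X c S) = sets (info_at X d S) \<and> law_at X c S = law_at X d S)"

definition coherent_control_system :: "('c, 'w) control_system \<Rightarrow> bool" where
  "coherent_control_system X \<longleftrightarrow>
     stochastic_control_system X \<and> adaptive_control_dynamics X \<and> stable_under_stopping X"


section \<open>Payoffs, the Bellman system and optimality\<close>

definition payoff ::
  "('c, 'w) control_system \<Rightarrow> 'c \<Rightarrow> ('c \<Rightarrow> 'w \<Rightarrow> ennreal) \<Rightarrow> 'w \<Rightarrow> ereal" where
  "payoff X c S = ereal_cond_exp (law X c) (info_at X c S) (reward X c)"

text \<open>
  \<open>V(c, \<S>)\<close> is determined only up to a.s. equality, so being a Bellman system is a property of
  \<open>V\<close>: any choice of versions is admitted. Lemma \<open>bellman_system_exists\<close> below shows that there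
  always is one.
\<close>

definition bellman_system ::
  "('c, 'w) control_system \<Rightarrow> ('c \<Rightarrow> ('c \<Rightarrow> 'w \<Rightarrow> ennreal) \<Rightarrow> 'w \<Rightarrow> ereal) \<Rightarrow> bool" where
  "bellman_system X V \<longleftrightarrow>
     (\<forall>c\<in>controls X. \<forall>S\<in>control_times X.
        is_esssup (law_at X c S) (reach X c S) (\<lambda>d. payoff X d S) (V c S))"

definition conditionally_optimal ::
  "('c, 'w) control_system \<Rightarrow> ('c \<Rightarrow> ('c \<Rightarrow> 'w \<Rightarrow> ennreal) \<Rightarrow> 'w \<Rightarrow> ereal)
     \<Rightarrow> 'c \<Rightarrow> ('c \<Rightarrow> 'w \<Rightarrow> ennreal) \<Rightarrow> bool" where
  "conditionally_optimal X V c S \<longleftrightarrow> (AE \<omega> in law X c. V c S \<omega> = payoff X c S \<omega>)"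

definition expected_reward :: "('c, 'w) control_system \<Rightarrow> 'c \<Rightarrow> ereal" where
  "expected_reward X c = ereal_expectation (law X c) (reward X c)"

definition optimal_value :: "('c, 'w) control_system \<Rightarrow> ereal" where
  "optimal_value X = (SUP c\<in>controls X. expected_reward X c)"

definition optimal :: "('c, 'w) control_system \<Rightarrow> 'c \<Rightarrow> bool" where
  "optimal X c \<longleftrightarrow> expected_reward X c = optimal_value X"

definition weak_upwards_lattice :: "('c, 'w) control_system \<Rightarrow> bool" where
  "weak_upwards_lattice X \<longleftrightarrow>
     (\<forall>c\<in>controls X. \<forall>S\<in>control_times X. \<forall>\<epsilon>>0::real. \<forall>M>0::real.
        \<forall>d\<in>reach X c S. \<forall>d'\<in>reach X c S. \<exists>d''\<in>reach X c S.
          AE \<omega> in law X c.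
            max (min (ereal M) (payoff X d S \<omega>)) (min (ereal M) (payoff X d' S \<omega>)) - ereal \<epsilon>
              \<le> payoff X d'' S \<omega>)"

definition supermartingale_system ::
  "('c, 'w) control_system \<Rightarrow> ('c \<Rightarrow> ('c \<Rightarrow> 'w \<Rightarrow> ennreal) \<Rightarrow> 'w \<Rightarrow> ereal) \<Rightarrow> bool" where
  "supermartingale_system X Y \<longleftrightarrow>
     (\<forall>c\<in>controls X. \<forall>S\<in>control_times X.
        Y c S \<in> borel_measurable (info_at X c S) \<and>
        (\<forall>d\<in>controls X. equiv_at X S c d \<longrightarrow>
           (AE \<omega> in law X c. Y c S \<omega> = Y d S \<omega>) \<and> (AE \<omega> in law X d. Y c S \<omega> = Y d S \<omega>)) \<and>
        neg_integral (law X c) (Y c S) < \<infinity>) \<and>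
     (\<forall>S\<in>control_times X. \<forall>T\<in>control_times X. \<forall>c\<in>controls X. precedes X c S T \<longrightarrow>
        (AE \<omega> in law X c. ereal_cond_exp (law X c) (info_at X c S) (Y c T) \<omega> \<le> Y c S \<omega>))"

definition martingale_of ::
  "('c, 'w) control_system \<Rightarrow> 'c \<Rightarrow> (('c \<Rightarrow> 'w \<Rightarrow> ennreal) \<Rightarrow> 'w \<Rightarrow> ereal) \<Rightarrow> bool" where
  "martingale_of X c Y \<longleftrightarrow>
     (\<forall>T\<in>control_times X.
        Y T \<in> borel_measurable (info_at X c T) \<and> ereal_integrable (law X c) (Y T)) \<and>
     (\<forall>S\<in>control_times X. \<forall>T\<in>control_times X. precedes X c S T \<longrightarrow>
        (AE \<omega> in law X c. ereal_cond_exp (law X c) (info_at X c S) (Y T) \<omega> = Y S \<omega>))"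


section \<open>Sanity checks\<close>

lemma sets_info_infinity:
  assumes "stochastic_control_system X" "c \<in> controls X"
  shows "sets (info_infinity X c) =
           sigma_sets (sample_space X) (\<Union>t\<in>time_set X. sets (info X c t))"
    and "subalgebra (events X c) (info_infinity X c)"
proof -
  have sp: "space (law X c) = sample_space X" and F: "subalgebra (law X c) (events X c)"
    and G: "\<And>t. t \<in> time_set X \<Longrightarrow> subalgebra (events X c) (info X c t)"
    using assms by (simp_all add: stochastic_control_system_def)
  have spF: "space (events X c) = sample_space X"
    using F sp by (simp add: subalgebra_def)
  have sub: "(\<Union>t\<in>time_set X. sets (info X c t)) \<subseteq> sets (events X c)"
    using G by (auto simp: subalgebra_def)
  have pow: "(\<Union>t\<in>time_set X. sets (info X c t)) \<subseteq> Pow (sample_space X)"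
    using sub sets.space_closed[of "events X c"] spF by auto
  show 1: "sets (info_infinity X c) =
           sigma_sets (sample_space X) (\<Union>t\<in>time_set X. sets (info X c t))"
    unfolding info_infinity_def using pow by (rule sets_measure_of)
  show "subalgebra (events X c) (info_infinity X c)"
    unfolding subalgebra_def 1
    using sets.sigma_sets_subset[OF sub] spF
    by (simp add: info_infinity_def space_measure_of_conv)
qed

text \<open>The family generating \<open>info_at X c S\<close> is already a \<open>\<sigma>\<close>-field.\<close>

lemma sets_info_at:
  assumes X: "stochastic_control_system X" "c \<in> controls X" and S: "control_time X S"
  shows "sets (info_at X c S) =
    {A \<in> sets (info_infinity X c). \<forall>t\<in>time_set X. {\<omega>\<in>A. S c \<omega> \<le> t} \<in> sets (info X c t)}"
    (is "_ = ?A")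
proof -
  let ?O = "sample_space X"
  have spi: "space (info_infinity X c) = ?O"
    by (simp add: info_infinity_def space_measure_of_conv)
  have st: "{\<omega> \<in> ?O. S c \<omega> \<le> t} \<in> sets (info X c t)" if "t \<in> time_set X" for t
    using S X that by (auto simp: control_time_def)
  have "sigma_algebra ?O ?A"
  proof (rule sigma_algebra_iff2[THEN iffD2], intro conjI)
    show "?A \<subseteq> Pow ?O"
      using sets.space_closed[of "info_infinity X c"] spi by auto
    show "{} \<in> ?A" by simp
    show "\<forall>s\<in>?A. ?O - s \<in> ?A"
    proof
      fix s assume s: "s \<in> ?A"
      have "?O - s \<in> sets (info_infinity X c)"
        using s sets.compl_sets[of s "info_infinity X c"] spi by auto
      moreover have "{\<omega>\<in>?O - s. S c \<omega> \<le> t} \<in> sets (info X c t)" if t: "t \<in> time_set X" for t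
      proof -
        have "{\<omega>\<in>?O - s. S c \<omega> \<le> t} = {\<omega> \<in> ?O. S c \<omega> \<le> t} - {\<omega>\<in>s. S c \<omega> \<le> t}"
          by auto
        then show ?thesis using st[OF t] s t by auto
      qed
      ultimately show "?O - s \<in> ?A" by simp
    qed
    show "\<forall>A. range A \<subseteq> ?A \<longrightarrow> (\<Union>i::nat. A i) \<in> ?A"
    proof (intro allI impI)
      fix A :: "nat \<Rightarrow> 'b set" assume A: "range A \<subseteq> ?A"
      have "{\<omega>\<in>(\<Union>i. A i). S c \<omega> \<le> t} \<in> sets (info X c t)" if t: "t \<in> time_set X" for t
      proof -
        have "{\<omega>\<in>(\<Union>i. A i). S c \<omega> \<le> t} = (\<Union>i. {\<omega>\<in>A i. S c \<omega> \<le> t})" by auto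
        moreover have "{\<omega>\<in>A i. S c \<omega> \<le> t} \<in> sets (info X c t)" for i
          using A t by blast
        ultimately show ?thesis by (simp add: sets.countable_UN)
      qed
      moreover have "(\<Union>i. A i) \<in> sets (info_infinity X c)" using A by auto
      ultimately show "(\<Union>i. A i) \<in> ?A" by simp
    qed
  qed
  then show ?thesis
    unfolding info_at_def by (rule sigma_algebra.sets_measure_of_eq)
qed

lemma subalgebra_info_at:
  assumes X: "stochastic_control_system X" "c \<in> controls X" and S: "control_time X S"
  shows "subalgebra (law X c) (info_at X c S)"
proof -
  have "subalgebra (law X c) (events X c)" and sp: "space (law X c) = sample_space X"
    using X by (simp_all add: stochastic_control_system_def)
  with sets_info_infinity(2)[OF X] show ?thesis
    using sets_info_at[OF assms]
    by (auto simp: subalgebra_def info_at_def space_measure_of_conv)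
qed

lemma is_esssup_exists:
  fixes X :: "'i \<Rightarrow> 'w \<Rightarrow> ereal"
  assumes M: "finite_measure M" and X: "\<And>i. i \<in> I \<Longrightarrow> X i \<in> borel_measurable M"
  shows "\<exists>Y. is_esssup M I X Y"
proof -
  interpret finite_measure M by (rule M)
  let ?U = "\<lambda>(q::rat) J. {x \<in> space M. \<exists>i\<in>J. ereal (of_rat q) < X i x}"
  let ?\<C> = "{J. countable J \<and> J \<subseteq> I}"
  have meas: "?U q J \<in> sets M" if "J \<in> ?\<C>" for q J
  proof -
    have eq: "?U q J = (\<Union>i\<in>J. {x \<in> space M. ereal (of_rat q) < X i x})" by auto
    show ?thesis
      unfolding eq 
    proof (rule sets.countable_UN'')
      show "{x \<in> space M. ereal (of_rat q) < X i x} \<in> sets M" if "i \<in> J" for i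
      proof -
        have [measurable]: "X i \<in> borel_measurable M" using X that \<open>J \<in> ?\<C>\<close> by blast
        show ?thesis by measurable
      qed
    qed (use that in simp)
  qed
  have "\<exists>J\<in>?\<C>. \<forall>K\<in>?\<C>. J \<subseteq> K \<longrightarrow> measure M (?U q K) = measure M (?U q J)" for q
  proof -
    let ?s = "SUP J\<in>?\<C>. measure M (?U q J)"
    have bdd: "bdd_above ((\<lambda>J. measure M (?U q J)) ` ?\<C>)"
      by (rule bdd_aboveI[of _ "measure M (space M)"]) (auto intro: bounded_measure)
    have ne: "?\<C> \<noteq> {}" by auto
    have "\<exists>J. J \<in> ?\<C> \<and> ?s - 1 / real (Suc n) < measure M (?U q J)" for n
    proof -
      have "?s - 1 / real (Suc n) < ?s" by simp
      then show ?thesis unfolding less_cSUP_iff[OF ne bdd] by blast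
    qed
    then have "\<exists>J. \<forall>n. J n \<in> ?\<C> \<and> ?s - 1 / real (Suc n) < measure M (?U q (J n))"
      by (intro choice allI)
    then obtain J where J0: "\<forall>n. J n \<in> ?\<C> \<and> ?s - 1 / real (Suc n) < measure M (?U q (J n))" ..
    have J: "J n \<in> ?\<C>" "?s - 1 / real (Suc n) < measure M (?U q (J n))" for n
      by (rule conjunct1[OF J0[THEN spec]]) (rule conjunct2[OF J0[THEN spec]])
    let ?J = "\<Union>n. J n"
    have JC: "?J \<in> ?\<C>" using J(1) by auto
    have ge: "?s \<le> measure M (?U q ?J)"
    proof (rule field_le_epsilon)
      fix e :: real assume "0 < e"
      then obtain n where n: "1 / real (Suc n) < e"
        using nat_approx_posE by blast
      have "measure M (?U q (J n)) \<le> measure M (?U q ?J)"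
        using meas[OF JC] by (intro finite_measure_mono) auto
      with J(2)[of n] n show "?s \<le> measure M (?U q ?J) + e" by linarith
    qed
    have "measure M (?U q K) = measure M (?U q ?J)" if K: "K \<in> ?\<C>" "?J \<subseteq> K" for K
    proof (rule antisym)
      show "measure M (?U q K) \<le> measure M (?U q ?J)"
        using cSUP_upper[OF K(1) bdd] ge by linarith
      show "measure M (?U q ?J) \<le> measure M (?U q K)"
        using meas[OF K(1)] K(2) by (intro finite_measure_mono) blast+
    qed
    with JC show ?thesis by blast
  qed
  then have "\<exists>J. \<forall>q. J q \<in> ?\<C> \<and>
      (\<forall>K\<in>?\<C>. J q \<subseteq> K \<longrightarrow> measure M (?U q K) = measure M (?U q (J q)))"
    unfolding Bex_def by (intro choice allI)
  then obtain J where J0: "\<forall>q. J q \<in> ?\<C> \<and>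
      (\<forall>K\<in>?\<C>. J q \<subseteq> K \<longrightarrow> measure M (?U q K) = measure M (?U q (J q)))" ..
  have J: "J q \<in> ?\<C>"
    "K \<in> ?\<C> \<Longrightarrow> J q \<subseteq> K \<Longrightarrow> measure M (?U q K) = measure M (?U q (J q))" for q K
    by (rule conjunct1[OF J0[THEN spec]])
      (rule conjunct2[OF J0[THEN spec], THEN bspec, THEN mp])
  define L where "L = (\<Union>q. J q)"
  have L: "L \<in> ?\<C>" using J(1) by (auto simp: L_def)
  define Y where "Y = (\<lambda>x. SUP i\<in>L. X i x)"
  have "Y \<in> borel_measurable M"
    unfolding Y_def using L X by (intro borel_measurable_SUP) auto
  moreover have "AE x in M. X i x \<le> Y x" if i: "i \<in> I" for i
  proof -
    have iL: "insert i L \<in> ?\<C>" using i L by auto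
    have "AE x in M. x \<notin> ?U q (insert i L) - ?U q L" for q
    proof -
      have "measure M (?U q (insert i L)) = measure M (?U q (J q))"
        using iL by (intro J(2)) (auto simp: L_def)
      moreover have "measure M (?U q L) = measure M (?U q (J q))"
        using L by (intro J(2)) (auto simp: L_def)
      moreover have "measure M (?U q (insert i L) - ?U q L)
          = measure M (?U q (insert i L)) - measure M (?U q L)"
        using meas[OF iL] meas[OF L] by (intro finite_measure_Diff) auto
      ultimately have "measure M (?U q (insert i L) - ?U q L) = 0" by linarith
      then have "?U q (insert i L) - ?U q L \<in> null_sets M"
        using meas[OF iL, of q] meas[OF L, of q] by (simp add: null_sets_def emeasure_eq_measure)
      then show ?thesis by (rule AE_not_in)
    qed
    then have "AE x in M. \<forall>q. x \<notin> ?U q (insert i L) - ?U q L"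
      by (simp add: AE_all_countable)
    then show ?thesis
      using AE_space
    proof eventually_elim
      fix x assume x: "\<forall>q. x \<notin> ?U q (insert i L) - ?U q L" "x \<in> space M"
      show "X i x \<le> Y x"
      proof (rule ccontr)
        assume "\<not> X i x \<le> Y x"
        then obtain r where r: "Y x < ereal r" "ereal r < X i x"
          using ereal_dense2[of "Y x" "X i x"] by (auto simp: not_le)
        then obtain r' where r': "ereal r < ereal r'" "ereal r' < X i x"
          using ereal_dense2 by blast
        then obtain q where q: "r < of_rat q" "of_rat q < r'"
          using of_rat_dense[of r r'] by auto
        have "ereal (of_rat q) < X i x" using q r' by (meson less_ereal.simps(1) less_trans)
        then obtain j where "j \<in> L" "ereal (of_rat q) < X j x"
          using x by auto
        then have "ereal (of_rat q) < Y x" by (auto simp: Y_def less_SUP_iff)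
        with r q show False by (meson less_ereal.simps(1) less_trans less_irrefl)
      qed
    qed
  qed
  moreover have "AE x in M. Y x \<le> Z x" if Z: "\<forall>i\<in>I. AE x in M. X i x \<le> Z x" for Z
  proof -
    have "AE x in M. \<forall>i\<in>L. X i x \<le> Z x"
      using L Z by (subst AE_ball_countable) auto
    then show ?thesis by eventually_elim (auto simp: Y_def intro: SUP_least)
  qed
  ultimately show ?thesis unfolding is_esssup_def by blast
qed

lemma bellman_system_exists:
  assumes "coherent_control_system X"
  shows "\<exists>V. bellman_system X V"
proof -
  have X: "stochastic_control_system X" and A: "adaptive_control_dynamics X"
    and St: "stable_under_stopping X"
    using assms by (auto simp: coherent_control_system_def)
  have "\<exists>Y. is_esssup (law_at X c S) (reach X c S) (\<lambda>d. payoff X d S) Y"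
    if c: "c \<in> controls X" and S: "S \<in> control_times X" for c S
  proof (rule is_esssup_exists)
    have ct: "control_time X S" using A S by (auto simp: adaptive_control_dynamics_def)
    have sub: "subalgebra (law X c) (info_at X c S)" by (rule subalgebra_info_at[OF X c ct])
    have "prob_space (law X c)" using X c by (auto simp: stochastic_control_system_def)
    then show "finite_measure (law_at X c S)"
      unfolding law_at_def
      by (intro finite_measure_restr_to_subalg[OF sub]) (simp add: prob_space_def)
    fix d assume d: "d \<in> reach X c S"
    have cd: "c \<in> reach X c S" and dC: "d \<in> controls X"
      using A c S d by (auto simp: adaptive_control_dynamics_def)
    have "equiv_at X S c d" using c cd d by (auto simp: equiv_at_def)
    then have eq: "sets (info_at X c S) = sets (info_at X d S)"
      using St S c dC by (auto simp: stable_under_stopping_def)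
    have "payoff X d S \<in> borel_measurable (info_at X d S)"
      unfolding payoff_def ereal_cond_exp_def by measurable
    then have "payoff X d S \<in> borel_measurable (info_at X c S)"
      by (simp cong: measurable_cong_sets add: eq)
    then show "payoff X d S \<in> borel_measurable (law_at X c S)"
      unfolding law_at_def using sub by (intro measurable_in_subalg)
  qed
  then have "\<forall>c S. \<exists>Y. c \<in> controls X \<longrightarrow> S \<in> control_times X \<longrightarrow>
      is_esssup (law_at X c S) (reach X c S) (\<lambda>d. payoff X d S) Y"
    by blast
  then obtain V where "\<forall>c S. c \<in> controls X \<longrightarrow> S \<in> control_times X \<longrightarrow>
      is_esssup (law_at X c S) (reach X c S) (\<lambda>d. payoff X d S) (V c S)"
    by metis
  then show ?thesis unfolding bellman_system_def by blast
qed

end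

theory Submission
  imports Defs
begin

text \<open>
  Everything is reduced to expectations over events \<open>A\<close>. If \<open>A\<close> is known at \<open>\<T>\<close>, the lattice property
  lets a countable family of payoffs that attains the essential supremum \<open>V(c, \<T>)\<close> be replaced by
  single controls, up to an arbitrarily small error, so that by monotone convergence
  \<open>E\<^sup>c[V(c, \<T>); A] \<le> sup {E\<^sup>d[J(d); A] | d. d \<in> \<D>(c, \<T>)}\<close>. For \<open>\<S> \<le> \<T>\<close> and \<open>A\<close> known at \<open>\<S>\<close> every
  \<open>d \<in> \<D>(c, \<T>)\<close> lies in \<open>\<D>(c, \<S>)\<close>, hence \<open>E\<^sup>d[J(d); A] \<le> E\<^sup>c[V(c, \<S>); A]\<close>: this is the supermartingale
  property, and with \<open>A = \<Omega>\<close> the first bound gives \<open>E\<^sup>c[V(c, \<T>)] \<le> v\<close>. The remaining claims compare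
  \<open>J(c, \<T>) \<le> V(c, \<T>)\<close> with equal finite expectations. For the converse, \<open>v \<le> E\<^sup>c[V(c, 0)]\<close> always holds, and
  uniform integrability carries this bound over to the limit \<open>V(c, \<infinity>) = J(c, \<infinity>)\<close>.
\<close>

section \<open>Expectations of extended-real functions\<close>

lemma ereal_eq_pos_minus_neg: "x = enn2ereal (e2ennreal x) - enn2ereal (e2ennreal (- x))"
proof (cases "0 \<le> x")
  case True
  then show ?thesis by (simp add: enn2ereal_e2ennreal e2ennreal_neg zero_ennreal.rep_eq)
next
  case False
  then have "0 \<le> - x" by auto
  with False show ?thesis by (simp add: enn2ereal_e2ennreal e2ennreal_neg zero_ennreal.rep_eq)
qed

lemma ereal_expectation_mono_AE:
  assumes "AE x in M. f x \<le> g x"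
  shows "ereal_expectation M f \<le> ereal_expectation M g"
  unfolding ereal_expectation_def neg_integral_def
  using assms
  by (intro ereal_minus_mono)
    (auto simp: less_eq_ennreal.rep_eq[symmetric] intro!: nn_integral_mono_AE e2ennreal_mono elim!: eventually_mono)

lemma ereal_expectation_cong_AE:
  assumes "AE x in M. f x = g x"
  shows "ereal_expectation M f = ereal_expectation M g"
  using assms by (intro antisym ereal_expectation_mono_AE) (auto elim: eventually_mono)

lemma neg_integral_mono_AE:
  assumes "AE x in M. f x \<le> g x"
  shows "neg_integral M g \<le> neg_integral M f"
  unfolding neg_integral_def using assms
  by (auto intro!: nn_integral_mono_AE e2ennreal_mono elim!: eventually_mono)

text \<open>\<open>p\<close> and \<open>n\<close> may overlap, so they need not be the positive and
  negative parts of their difference. Those parts are the truncated differences \<open>p - n\<close>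
  and \<open>n - p\<close>; the identity \<open>(p - n) + n = p + (n - p)\<close> is integrated and
  then rearranged, which is legitimate because \<open>n\<close> has finite integral.\<close>

lemma ereal_expectation_diff:
  fixes p n :: "'w \<Rightarrow> ennreal"
  assumes [measurable]: "p \<in> borel_measurable M" "n \<in> borel_measurable M"
    and fin: "(\<integral>\<^sup>+ x. n x \<partial>M) < \<infinity>"
  shows "ereal_expectation M (\<lambda>x. enn2ereal (p x) - enn2ereal (n x))
    = enn2ereal (\<integral>\<^sup>+ x. p x \<partial>M) - enn2ereal (\<integral>\<^sup>+ x. n x \<partial>M)"
proof -
  have n_fin: "AE x in M. n x \<noteq> \<infinity>"
    using fin by (intro nn_integral_noteq_infinite) auto
  \<comment> \<open>Negating a difference swaps its terms except for
    \<open>\<infinity> - \<infinity>\<close>, which is \<open>\<infinity>\<close> in either order;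
    finiteness of \<open>n\<close> a.e. excludes that case.\<close>
  have neg: "neg_integral M (\<lambda>x. enn2ereal (p x) - enn2ereal (n x)) = (\<integral>\<^sup>+ x. n x - p x \<partial>M)"
    unfolding neg_integral_def using n_fin
  proof (intro nn_integral_cong_AE, eventually_elim)
    fix x assume "n x \<noteq> \<infinity>"
    then have "- (enn2ereal (p x) - enn2ereal (n x)) = enn2ereal (n x) - enn2ereal (p x)"
      by (intro ereal_minus_diff_eq) auto
    then show "e2ennreal (- (enn2ereal (p x) - enn2ereal (n x))) = n x - p x" by simp
  qed
  \<comment> \<open>Subtraction in \<open>ennreal\<close> truncates at 0, except that
    \<open>\<infinity> - \<infinity>\<close> is \<open>\<infinity>\<close>; there \<open>b\<close>
    is infinite too and the identity survives.\<close>
  have zero: "a - b + b = b" if "a \<le> b" for a b :: ennreal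
    using that by (cases "a = \<infinity>") (auto simp: top_unique diff_eq_0_ennreal less_top)
  have "(\<integral>\<^sup>+ x. p x - n x \<partial>M) + (\<integral>\<^sup>+ x. n x \<partial>M) = (\<integral>\<^sup>+ x. (p x - n x) + n x \<partial>M)"
    by (intro nn_integral_add[symmetric]) auto
  \<comment> \<open>Both integrands equal the maximum of \<open>p x\<close> and
    \<open>n x\<close>.\<close>
  also have "\<dots> = (\<integral>\<^sup>+ x. p x + (n x - p x) \<partial>M)"
  proof (intro nn_integral_cong)
    fix x
    show "(p x - n x) + n x = p x + (n x - p x)"
    proof (cases "p x \<le> n x")
      case True
      then show ?thesis by (simp only: zero add_diff_inverse_ennreal)
    next
      case False
      then have "n x \<le> p x" by simp
      from zero[OF this] add_diff_inverse_ennreal[OF this] show ?thesis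
        by (metis add.commute)
    qed
  qed
  also have "\<dots> = (\<integral>\<^sup>+ x. p x \<partial>M) + (\<integral>\<^sup>+ x. n x - p x \<partial>M)"
    by (intro nn_integral_add) auto
  finally have eq: "(\<integral>\<^sup>+ x. p x - n x \<partial>M) + (\<integral>\<^sup>+ x. n x \<partial>M)
    = (\<integral>\<^sup>+ x. p x \<partial>M) + (\<integral>\<^sup>+ x. n x - p x \<partial>M)" .
  have "(\<integral>\<^sup>+ x. n x - p x \<partial>M) \<le> (\<integral>\<^sup>+ x. n x \<partial>M)"
    by (intro nn_integral_mono diff_le_self_ennreal)
  then have fin': "(\<integral>\<^sup>+ x. n x - p x \<partial>M) < \<infinity>" using fin by simp
  have arith: "enn2ereal a - enn2ereal b = enn2ereal P - enn2ereal N"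
    if "a + N = P + b" "N < \<infinity>" "b < \<infinity>" for a b P N :: ennreal
    using that
    by (cases a; cases b; cases P; cases N) (auto simp: ennreal_plus[symmetric] simp del: ennreal_plus)
  show ?thesis
    unfolding ereal_expectation_def neg
    using arith[OF eq fin fin'] by simp
qed

text \<open>Positive parts increase, so monotone convergence applies. Negative parts decrease and
  are dominated by that of \<open>f 0\<close>, so dominated convergence applies; their finite limit
  makes the difference converge.\<close>

lemma ereal_expectation_LIMSEQ:
  fixes f :: "nat \<Rightarrow> 'w \<Rightarrow> ereal"
  assumes inc: "incseq f" and [measurable]: "\<And>n. f n \<in> borel_measurable M"
    and fin: "neg_integral M (f 0) < \<infinity>"
  shows "(\<lambda>n. ereal_expectation M (f n)) \<longlonglongrightarrow> ereal_expectation M (\<lambda>x. SUP n. f n x)"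
proof -
  have lim: "(\<lambda>n. f n x) \<longlonglongrightarrow> (SUP n. f n x)" for x
    using inc by (intro LIMSEQ_SUP) (auto simp: incseq_def le_fun_def)
  have [measurable]: "(\<lambda>x. SUP n. f n x) \<in> borel_measurable M" by measurable
  have le: "f 0 x \<le> f n x" for n x
    using inc by (auto simp: incseq_def le_fun_def)
  have "(\<lambda>n. \<integral>\<^sup>+ x. e2ennreal (f n x) \<partial>M) \<longlonglongrightarrow> (\<integral>\<^sup>+ x. e2ennreal (SUP n. f n x) \<partial>M)"
  proof (rule nn_integral_LIMSEQ)
    show "incseq (\<lambda>n x. e2ennreal (f n x))"
      using inc by (auto simp: incseq_def le_fun_def intro!: e2ennreal_mono)
  qed (auto intro!: tendsto_e2ennrealI lim)
  moreover have "(\<lambda>n. neg_integral M (f n)) \<longlonglongrightarrow> neg_integral M (\<lambda>x. SUP n. f n x)"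
    unfolding neg_integral_def
  proof (rule nn_integral_dominated_convergence)
    show "AE x in M. e2ennreal (- f n x) \<le> e2ennreal (- f 0 x)" for n
      using le by (auto intro!: e2ennreal_mono)
    show "(\<integral>\<^sup>+ x. e2ennreal (- f 0 x) \<partial>M) < \<infinity>" using fin by (simp add: neg_integral_def)
    show "AE x in M. (\<lambda>n. e2ennreal (- f n x)) \<longlonglongrightarrow> e2ennreal (- (SUP n. f n x))"
      by (intro AE_I2 tendsto_e2ennrealI tendsto_intros lim)
  qed auto
  moreover have "neg_integral M (\<lambda>x. SUP n. f n x) \<le> neg_integral M (f 0)"
    by (intro neg_integral_mono_AE AE_I2 SUP_upper) auto
  then have "neg_integral M (\<lambda>x. SUP n. f n x) < \<infinity>" using fin by simp
  ultimately show ?thesis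
    unfolding ereal_expectation_def
    by (intro tendsto_diff_ereal_general tendsto_enn2erealI) auto
qed

text \<open>The error is doubled because the positive and the negative part are estimated
  separately, each losing at most \<open>e\<close> on a space of mass at most 1.\<close>

lemma ereal_expectation_le_add:
  fixes f g :: "'w \<Rightarrow> ereal" and e :: real
  assumes le: "AE x in M. f x \<le> g x + ereal e" and e: "0 \<le> e"
    and [measurable]: "f \<in> borel_measurable M" "g \<in> borel_measurable M"
    and M: "emeasure M (space M) \<le> 1" and fin: "neg_integral M g < \<infinity>"
  shows "ereal_expectation M f \<le> ereal_expectation M g + ereal (2 * e)"
proof -
  have const: "(\<integral>\<^sup>+ x. ennreal e \<partial>M) \<le> ennreal e"
    using mult_left_mono[OF M, of "ennreal e"] by simp
  have "(\<integral>\<^sup>+ x. e2ennreal (f x) \<partial>M) \<le> (\<integral>\<^sup>+ x. e2ennreal (g x) + ennreal e \<partial>M)"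
    using le
  proof (intro nn_integral_mono_AE, eventually_elim)
    fix x assume "f x \<le> g x + ereal e"
    with e show "e2ennreal (f x) \<le> e2ennreal (g x) + ennreal e"
      by (cases "f x"; cases "g x") (auto simp: e2ennreal_neg ennreal_plus_if intro: ennreal_leI)
  qed
  also have "\<dots> \<le> (\<integral>\<^sup>+ x. e2ennreal (g x) \<partial>M) + ennreal e"
    using const by (subst nn_integral_add) (auto intro: add_left_mono)
  finally have pos: "(\<integral>\<^sup>+ x. e2ennreal (f x) \<partial>M) \<le> (\<integral>\<^sup>+ x. e2ennreal (g x) \<partial>M) + ennreal e" .
  have "neg_integral M g \<le> (\<integral>\<^sup>+ x. e2ennreal (- f x) + ennreal e \<partial>M)"
    unfolding neg_integral_def using le
  proof (intro nn_integral_mono_AE, eventually_elim)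
    fix x assume "f x \<le> g x + ereal e"
    with e show "e2ennreal (- g x) \<le> e2ennreal (- f x) + ennreal e"
      by (cases "f x"; cases "g x") (auto simp: e2ennreal_neg ennreal_plus_if intro: ennreal_leI)
  qed
  also have "\<dots> \<le> neg_integral M f + ennreal e"
    unfolding neg_integral_def
    using const by (subst nn_integral_add) (auto intro: add_left_mono)
  finally have neg: "neg_integral M g \<le> neg_integral M f + ennreal e" .
  have arith: "enn2ereal a - enn2ereal b \<le> enn2ereal P - enn2ereal N + ereal (2 * e)"
    if "a \<le> P + ennreal e" "N \<le> b + ennreal e" "N < \<infinity>" for a b P N :: ennreal
    using that e
    by (cases a; cases b; cases P; cases N) (auto simp: ennreal_plus[symmetric] top_unique simp del: ennreal_plus)
  show ?thesis
    unfolding ereal_expectation_def by (rule arith[OF pos neg fin])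
qed

text \<open>The order makes the positive parts increase and the negative parts decrease from
  \<open>f\<close> to \<open>g\<close>. With finite values, expectations that do not increase leave
  no room for either change, so the parts agree separately.\<close>

lemma AE_eq_of_ereal_expectation_le:
  fixes f g :: "'w \<Rightarrow> ereal"
  assumes le: "AE x in M. f x \<le> g x"
    and [measurable]: "f \<in> borel_measurable M" "g \<in> borel_measurable M"
    and fin: "neg_integral M f < \<infinity>" "ereal_expectation M f < \<infinity>"
    and ge: "ereal_expectation M g \<le> ereal_expectation M f"
  shows "AE x in M. f x = g x"
proof -
  \<comment> \<open>Nonnegative case: \<open>k - h\<close> is nonnegative and its integral
    vanishes.\<close>
  have AE_eq: "AE x in M. h x = k x"
    if le: "AE x in M. h x \<le> k x" and [measurable]: "h \<in> borel_measurable M" "k \<in> borel_measurable M"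
      and int: "(\<integral>\<^sup>+ x. k x \<partial>M) \<le> (\<integral>\<^sup>+ x. h x \<partial>M)" "(\<integral>\<^sup>+ x. h x \<partial>M) < \<infinity>"
    for h k :: "'w \<Rightarrow> ennreal"
  proof -
    have "(\<integral>\<^sup>+ x. k x - h x \<partial>M) = (\<integral>\<^sup>+ x. k x \<partial>M) - (\<integral>\<^sup>+ x. h x \<partial>M)"
      using le int by (intro nn_integral_diff) auto
    also have "\<dots> = 0" using int by (simp add: diff_eq_0_ennreal)
    finally have "AE x in M. k x - h x = 0" by (subst (asm) nn_integral_0_iff_AE) auto
    with le show ?thesis
      by eventually_elim (metis add.right_neutral add_diff_inverse_ennreal)
  qed
  have pos: "(\<integral>\<^sup>+ x. e2ennreal (f x) \<partial>M) \<le> (\<integral>\<^sup>+ x. e2ennreal (g x) \<partial>M)"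
    using le by (intro nn_integral_mono_AE) (auto intro: e2ennreal_mono elim!: eventually_mono)
  have neg: "neg_integral M g \<le> neg_integral M f" by (rule neg_integral_mono_AE[OF le])
  have arith: "b \<le> a \<and> n \<le> m \<and> a < \<infinity>"
    if "enn2ereal b - enn2ereal m \<le> enn2ereal a - enn2ereal n" "a \<le> b" "m \<le> n" "n < \<infinity>"
      "enn2ereal a - enn2ereal n < \<infinity>" for a b m n :: ennreal
    using that by (cases a; cases b; cases m; cases n) (auto simp: ennreal_leI top_unique)
  note * = arith[OF ge[unfolded ereal_expectation_def] pos neg fin(1) fin(2)[unfolded ereal_expectation_def]]
  have "AE x in M. e2ennreal (f x) = e2ennreal (g x)"
    using le * by (intro AE_eq) (auto intro: e2ennreal_mono elim!: eventually_mono)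
  \<comment> \<open>For the negative parts \<open>f\<close> and \<open>g\<close> exchange
    roles.\<close>
  moreover have "AE x in M. e2ennreal (- g x) = e2ennreal (- f x)"
    using le * neg fin by (intro AE_eq) (auto simp: neg_integral_def intro: e2ennreal_mono elim!: eventually_mono)
  ultimately show ?thesis
  proof eventually_elim
    fix x assume "e2ennreal (f x) = e2ennreal (g x)" "e2ennreal (- g x) = e2ennreal (- f x)"
    then show "f x = g x"
      using ereal_eq_pos_minus_neg[of "f x"] ereal_eq_pos_minus_neg[of "g x"] by simp
  qed
qed

lemma ereal_of_rat_dense:
  assumes "x < (y :: ereal)"
  shows "\<exists>q. x < ereal (of_rat q) \<and> ereal (of_rat q) < y"
proof -
  obtain a where a: "x < ereal a" "ereal a < y" using ereal_dense2[OF assms] by blast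
  obtain b where b: "ereal a < ereal b" "ereal b < y" using ereal_dense2[OF a(2)] by blast
  then obtain q where q: "a < of_rat q" "of_rat q < b" using of_rat_dense[of a b] by auto
  have "x < ereal (of_rat q)" using a(1) q(1) by (auto intro: less_trans)
  moreover have "ereal (of_rat q) < y" using b(2) q(2) by (auto intro: less_trans[of _ "ereal b"])
  ultimately show ?thesis by blast
qed

section \<open>Expectations over an event\<close>

text \<open>The expectation E[f; A] is taken as the expectation of \<open>f\<close> under the law
  cut down to \<open>A\<close>. Facts proved for arbitrary measures then apply to it directly, and
  no extended-real function has to be multiplied by an indicator.\<close>

abbreviation on_event :: "'w measure \<Rightarrow> 'w set \<Rightarrow> 'w measure" where
  "on_event M A \<equiv> density M (indicator A)"

lemma nn_integral_on_event:
  assumes "A \<in> sets M" "f \<in> borel_measurable M"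
  shows "(\<integral>\<^sup>+ x. f x \<partial>on_event M A) = (\<integral>\<^sup>+ x. indicator A x * f x \<partial>M)"
  using assms by (intro nn_integral_density) auto

lemma AE_on_event:
  assumes "A \<in> sets M" "AE x in M. P x"
  shows "AE x in on_event M A. P x"
  using assms(2) by (subst AE_density) (use assms(1) in auto)

lemma AE_on_eventI:
  assumes "A \<in> sets M" "\<And>x. x \<in> A \<Longrightarrow> P x"
  shows "AE x in on_event M A. P x"
  by (subst AE_density) (use assms in \<open>auto simp: indicator_def\<close>)

lemma emeasure_on_event_space:
  assumes "A \<in> sets M"
  shows "emeasure (on_event M A) (space (on_event M A)) = emeasure M A"
  using assms sets.sets_into_space[OF assms] by (simp add: emeasure_density Int_absorb2)

lemma neg_integral_on_event_le:
  assumes "A \<in> sets M" "f \<in> borel_measurable M"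
  shows "neg_integral (on_event M A) f \<le> neg_integral M f"
  unfolding neg_integral_def using assms
  by (subst nn_integral_on_event) (auto intro!: nn_integral_mono split: split_indicator)

lemma ereal_expectation_on_space:
  assumes "f \<in> borel_measurable M"
  shows "ereal_expectation (on_event M (space M)) f = ereal_expectation M f"
proof -
  have "(\<integral>\<^sup>+ x. g x \<partial>on_event M (space M)) = (\<integral>\<^sup>+ x. g x \<partial>M)" if "g \<in> borel_measurable M"
    for g :: "'a \<Rightarrow> ennreal"
    using that by (subst nn_integral_on_event) (auto intro!: nn_integral_cong)
  with assms show ?thesis
    by (simp add: ereal_expectation_def neg_integral_def)
qed

lemma ereal_expectation_const:
  assumes "finite_measure M"
  shows "ereal_expectation M (\<lambda>_. ereal r) = ereal (r * measure M (space M))"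
proof -
  interpret finite_measure M by (rule assms)
  show ?thesis
    by (cases "0 \<le> r")
      (auto simp: ereal_expectation_def neg_integral_def emeasure_eq_measure ennreal_neg
        ennreal_mult'[symmetric] ennreal_mult[symmetric] zero_ennreal.rep_eq mult_nonpos_nonneg)
qed

text \<open>Where \<open>f\<close> exceeds \<open>g\<close>, rationals \<open>q < r\<close> fit
  between them. On the event that \<open>g \<le> q\<close> and \<open>r \<le> f\<close>, the
  hypothesis gives \<open>r P \<le> q P\<close> for its probability \<open>P\<close>, so it is null;
  countably many such events cover the exceptional set. Comparing with constants keeps infinite
  values harmless.\<close>

lemma AE_le_of_expectation_on_event_le:
  fixes f g :: "'w \<Rightarrow> ereal"
  assumes M: "finite_measure M" and F: "subalgebra M F"
    and [measurable]: "f \<in> borel_measurable F" "g \<in> borel_measurable F"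
    and le: "\<And>A. A \<in> sets F \<Longrightarrow>
      ereal_expectation (on_event M A) f \<le> ereal_expectation (on_event M A) g"
  shows "AE x in M. f x \<le> g x"
proof -
  interpret finite_measure M by (rule M)
  let ?A = "\<lambda>q r::rat. {x \<in> space F. g x \<le> ereal (of_rat q) \<and> ereal (of_rat r) \<le> f x}"
  have null: "AE x in M. x \<notin> ?A q r" if qr: "q < r" for q r
  proof -
    have AF: "?A q r \<in> sets F" by measurable
    then have A: "?A q r \<in> sets M" using F unfolding subalgebra_def by blast
    have fin: "finite_measure (on_event M (?A q r))"
      by (rule finite_measureI) (simp only: emeasure_on_event_space[OF A] infinity_ennreal_def emeasure_finite simp_thms)
    have m: "measure (on_event M (?A q r)) (space (on_event M (?A q r))) = measure M (?A q r)"
      by (simp only: measure_def emeasure_on_event_space[OF A])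
    have "ereal (of_rat r * measure M (?A q r)) = ereal_expectation (on_event M (?A q r)) (\<lambda>_. ereal (of_rat r))"
      unfolding ereal_expectation_const[OF fin] m ..
    also have "\<dots> \<le> ereal_expectation (on_event M (?A q r)) f"
      using A by (intro ereal_expectation_mono_AE AE_on_eventI) auto
    also have "\<dots> \<le> ereal_expectation (on_event M (?A q r)) g" by (rule le[OF AF])
    also have "\<dots> \<le> ereal_expectation (on_event M (?A q r)) (\<lambda>_. ereal (of_rat q))"
      using A by (intro ereal_expectation_mono_AE AE_on_eventI) auto
    also have "\<dots> = ereal (of_rat q * measure M (?A q r))"
      unfolding ereal_expectation_const[OF fin] m ..
    finally have "of_rat r * measure M (?A q r) \<le> of_rat q * measure M (?A q r)" by simp
    moreover have "(of_rat q :: real) < of_rat r" using qr by (simp add: of_rat_less)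
    moreover have "m = 0" if "b * m \<le> a * m" "a < b" "0 \<le> m" for a b m :: real
      using that by (auto simp: mult_le_cancel_right)
    ultimately have "measure M (?A q r) = 0" using measure_nonneg by blast
    then have "?A q r \<in> null_sets M" using A by (simp add: null_sets_def emeasure_eq_measure)
    then show ?thesis by (rule AE_not_in)
  qed
  then have "AE x in M. \<forall>q r. q < r \<longrightarrow> x \<notin> ?A q r" by (simp add: AE_all_countable)
  then show ?thesis using AE_space
  proof eventually_elim
    fix x assume x: "\<forall>q r. q < r \<longrightarrow> x \<notin> ?A q r" "x \<in> space M"
    show "f x \<le> g x"
    proof (rule ccontr)
      assume "\<not> f x \<le> g x"
      then obtain r where r: "g x < ereal (of_rat r)" "ereal (of_rat r) < f x"
        using ereal_of_rat_dense[of "g x" "f x"] by (auto simp: not_le)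
      \<comment> \<open>A second level below \<open>r\<close> provides the strict gap that makes the
        test event null.\<close>
      obtain q where q: "g x < ereal (of_rat q)" "ereal (of_rat q) < ereal (of_rat r)"
        using ereal_of_rat_dense[OF r(1)] by auto
      have "q < r" using q(2) by (simp add: of_rat_less)
      moreover have "x \<in> ?A q r"
        using q(1) r(2) \<open>x \<in> space M\<close> F by (auto simp: subalgebra_def)
      ultimately show False using x(1) by blast
    qed
  qed
qed

section \<open>Conditional expectations\<close>

lemma borel_measurable_ereal_cond_exp [measurable]: "ereal_cond_exp M F f \<in> borel_measurable F"
  unfolding ereal_cond_exp_def by measurable

context finite_measure_subalgebra
begin

text \<open>The averaging identity holds for the conditional expectations of the two parts of
  \<open>f\<close>. These are generally not the two parts of the conditional expectation, so
  \<open>ereal_expectation_diff\<close> is what recombines them.\<close>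

lemma expectation_on_event_ereal_cond_exp:
  assumes [measurable]: "f \<in> borel_measurable M" "A \<in> sets F"
    and fin: "neg_integral M f < \<infinity>"
  shows "ereal_expectation (on_event M A) (ereal_cond_exp M F f) = ereal_expectation (on_event M A) f"
proof -
  have A[measurable]: "A \<in> sets M" using subalg assms(2) by (auto simp: subalgebra_def)
  have int: "(\<integral>\<^sup>+ x. nn_cond_exp M F g x \<partial>on_event M A) = (\<integral>\<^sup>+ x. g x \<partial>on_event M A)"
    if [measurable]: "g \<in> borel_measurable M" for g
    by (simp add: nn_integral_on_event nn_cond_exp_intg)
  have "(\<integral>\<^sup>+ x. e2ennreal (- f x) \<partial>on_event M A) < \<infinity>"
    using neg_integral_on_event_le[OF A assms(1)] fin by (simp add: neg_integral_def)
  then show ?thesis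
    unfolding ereal_cond_exp_def by (subst ereal_expectation_diff)
      (simp_all add: int ereal_expectation_def neg_integral_def)
qed

lemma ereal_expectation_cond_exp:
  assumes [measurable]: "f \<in> borel_measurable M" and fin: "neg_integral M f < \<infinity>"
  shows "ereal_expectation M (ereal_cond_exp M F f) = ereal_expectation M f"
proof -
  have "space M \<in> sets F" using subalg by (metis sets.top subalgebra_def)
  moreover have "ereal_cond_exp M F f \<in> borel_measurable M"
    by (rule measurable_from_subalg[OF subalg]) measurable
  ultimately show ?thesis
    using expectation_on_event_ereal_cond_exp[OF assms(1) _ fin, of "space M"] assms(1)
    by (simp add: ereal_expectation_on_space)
qed

text \<open>The negative part of a difference \<open>p - n\<close> of nonnegative terms is at most
  \<open>n\<close>, here the conditional expectation of the negative part of
  \<open>f\<close>.\<close>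

lemma neg_integral_ereal_cond_exp_le:
  assumes [measurable]: "f \<in> borel_measurable M"
  shows "neg_integral M (ereal_cond_exp M F f) \<le> neg_integral M f"
proof -
  have le: "e2ennreal (- (enn2ereal p - enn2ereal n)) \<le> n" for p n
    by (cases p; cases n) (auto simp: e2ennreal_neg intro!: ennreal_leI)
  have "neg_integral M (ereal_cond_exp M F f) \<le> (\<integral>\<^sup>+ x. nn_cond_exp M F (\<lambda>x. e2ennreal (- f x)) x \<partial>M)"
    unfolding neg_integral_def ereal_cond_exp_def by (intro nn_integral_mono le)
  also have "\<dots> = (\<integral>\<^sup>+ x. 1 * nn_cond_exp M F (\<lambda>x. e2ennreal (- f x)) x \<partial>M)" by simp
  also have "\<dots> = neg_integral M f"
    unfolding neg_integral_def by (subst nn_cond_exp_intg) auto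
  finally show ?thesis .
qed

end

section \<open>Essential suprema of upwards directed families\<close>

text \<open>Exhaustion: for each rational level \<open>q\<close>, sequences in \<open>I\<close> are
  chosen whose events "some member exceeds \<open>q\<close>" approach the largest possible measure.
  Merged into one sequence \<open>d\<close>, they attain that measure at all levels at once.
  Adjoining any \<open>i\<close> to \<open>d\<close> then gains only null sets, so the supremum
  along \<open>d\<close> is an a.e. upper bound of the family, and minimality of \<open>Y\<close>
  applies.\<close>

lemma is_esssup_le_countable_SUP:
  fixes X :: "'i \<Rightarrow> 'w \<Rightarrow> ereal"
  assumes M: "finite_measure M" and X: "\<And>i. i \<in> I \<Longrightarrow> X i \<in> borel_measurable M"
    and Y: "is_esssup M I X Y" and "I \<noteq> {}"
  obtains d :: "nat \<Rightarrow> 'i" where "range d \<subseteq> I" "AE x in M. Y x \<le> (SUP n. X (d n) x)"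
proof -
  interpret finite_measure M by (rule M)
  let ?S = "{d :: nat \<Rightarrow> 'i. range d \<subseteq> I}"
  let ?U = "\<lambda>(q::rat) d. {x \<in> space M. \<exists>n::nat. ereal (of_rat q) < X (d n) x}"
  have S: "?S \<noteq> {}" using \<open>I \<noteq> {}\<close> by auto
  have meas: "?U q d \<in> sets M" if "d \<in> ?S" for q d
  proof -
    have [measurable]: "X (d n) \<in> borel_measurable M" for n using X that by auto
    show ?thesis by measurable
  qed
  have "\<exists>f :: nat \<Rightarrow> ennreal. range f \<subseteq> (\<lambda>d. emeasure M (?U q d)) ` ?S
      \<and> (SUP d\<in>?S. emeasure M (?U q d)) = (SUP k. f k)" for q
    by (rule ennreal_SUP_countable_SUP[OF S])
  then have "\<forall>q. \<exists>f :: nat \<Rightarrow> ennreal. range f \<subseteq> (\<lambda>d. emeasure M (?U q d)) ` ?S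
      \<and> (SUP d\<in>?S. emeasure M (?U q d)) = (SUP k. f k)" ..
  from choice[OF this] obtain f :: "rat \<Rightarrow> nat \<Rightarrow> ennreal" where
    f: "range (f q) \<subseteq> (\<lambda>d. emeasure M (?U q d)) ` ?S"
    "(SUP d\<in>?S. emeasure M (?U q d)) = (SUP k. f q k)" for q
    by blast
  have "\<exists>d\<in>?S. f q k = emeasure M (?U q d)" for q k using f(1)[of q] by blast
  then have "\<forall>p. \<exists>d. d \<in> ?S \<and> f (fst p) (snd p) = emeasure M (?U (fst p) d)" by blast
  from choice[OF this] obtain D' where
    "\<forall>p. D' p \<in> ?S \<and> f (fst p) (snd p) = emeasure M (?U (fst p) (D' p))" ..
  then have D: "D' (q, k) \<in> ?S" "f q k = emeasure M (?U q (D' (q, k)))" for q k by auto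
  \<comment> \<open>The three coordinates are the level, the index of the approximating sequence for
    that level, and the position in that sequence.\<close>
  define d where "d n = (case from_nat n of (q, k, m) \<Rightarrow> D' (q, k) m)" for n
  have D_I: "D' (q, k) m \<in> I" for q k m using D(1)[of q k] by auto
  have dI: "range d \<subseteq> I" by (auto simp: d_def D_I split: prod.split)
  have D_d: "\<exists>n. d n = D' (q, k) m" for q k m
    by (rule exI[of _ "to_nat (q, k, m)"]) (simp add: d_def)
  have max: "(SUP e\<in>?S. emeasure M (?U q e)) \<le> emeasure M (?U q d)" for q
    unfolding f(2)
  proof (rule SUP_least)
    fix k show "f q k \<le> emeasure M (?U q d)"
      unfolding D(2) using D_d[of q k] dI by (intro emeasure_mono meas) (auto, metis)
  qed
  have "AE x in M. X i x \<le> (SUP n. X (d n) x)" if i: "i \<in> I" for i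
  proof -
    \<comment> \<open>The sequence \<open>d\<close> with \<open>i\<close> put in front; maximality
      of \<open>d\<close> compares the two at every level.\<close>
    let ?e = "case_nat i d"
    have "range ?e \<subseteq> I" by (rule image_subsetI) (use i dI in \<open>auto split: nat.split intro: subsetD[OF dI]\<close>)
    then have e: "?e \<in> ?S" by simp
    have sub: "?U q d \<subseteq> ?U q ?e" for q by (auto intro: exI[of _ "Suc n" for n])
    have "AE x in M. x \<notin> ?U q ?e - ?U q d" for q
    proof -
      have "emeasure M (?U q ?e) \<le> emeasure M (?U q d)"
        using SUP_upper[OF e, of "\<lambda>d. emeasure M (?U q d)"] max[of q] by (rule order_trans)
      moreover have "emeasure M (?U q ?e - ?U q d) = emeasure M (?U q ?e) - emeasure M (?U q d)"
        using meas[OF e, of q] meas[of d q] dI sub by (intro emeasure_Diff) auto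
      ultimately have "?U q ?e - ?U q d \<in> null_sets M"
        using meas[OF e, of q] meas[of d q] dI by (intro null_setsI) (auto simp: diff_eq_0_ennreal less_top[symmetric])
      then show ?thesis by (rule AE_not_in)
    qed
    then have "AE x in M. \<forall>q. x \<notin> ?U q ?e - ?U q d" by (simp add: AE_all_countable)
    then show ?thesis using AE_space
    proof eventually_elim
      fix x assume x: "\<forall>q. x \<notin> ?U q ?e - ?U q d" "x \<in> space M"
      show "X i x \<le> (SUP n. X (d n) x)"
      proof (rule ccontr)
        assume "\<not> X i x \<le> (SUP n. X (d n) x)"
        then obtain q where q: "(SUP n. X (d n) x) < ereal (of_rat q)" "ereal (of_rat q) < X i x"
          using ereal_of_rat_dense by (auto simp: not_le)
        have "x \<in> ?U q ?e" using q(2) x(2) by (auto intro: exI[of _ 0])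
        then have "x \<in> ?U q d" using x(1) by blast
        then have "ereal (of_rat q) < (SUP n. X (d n) x)" by (auto simp: less_SUP_iff)
        with q(1) show False by simp
      qed
    qed
  qed
  moreover have "(\<lambda>x. SUP n. X (d n) x) \<in> borel_measurable M"
    using X dI by (intro borel_measurable_SUP) auto
  ultimately have "AE x in M. Y x \<le> (SUP n. X (d n) x)"
    using Y by (auto simp: is_esssup_def)
  with dI show ?thesis by (rule that)
qed

text \<open>Induction on the size of the family: half of the error goes to the control found for the
  earlier members, half to joining it with the new member. The cap \<open>K\<close> stays fixed
  throughout.\<close>

lemma lattice_finite_family:
  fixes X :: "'i \<Rightarrow> 'w \<Rightarrow> ereal" and d :: "nat \<Rightarrow> 'i"
  assumes lattice: "\<And>\<epsilon> K i j. 0 < \<epsilon> \<Longrightarrow> 0 < K \<Longrightarrow> i \<in> I \<Longrightarrow> j \<in> I \<Longrightarrow> \<exists>k\<in>I. AE x in M.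
      max (min (ereal K) (X i x)) (min (ereal K) (X j x)) - ereal \<epsilon> \<le> X k x"
    and d: "range d \<subseteq> I" and "0 < K" "0 < \<epsilon>"
  shows "\<exists>i\<in>I. AE x in M. \<forall>k\<le>n. min (ereal K) (X (d k) x) \<le> X i x + ereal \<epsilon>"
  using \<open>0 < \<epsilon>\<close>
proof (induction n arbitrary: \<epsilon>)
  case 0
  have "AE x in M. \<forall>k\<le>0. min (ereal K) (X (d k) x) \<le> X (d 0) x + ereal \<epsilon>"
  proof (intro AE_I2 allI impI)
    fix x and k :: nat assume "k \<le> 0"
    then show "min (ereal K) (X (d k) x) \<le> X (d 0) x + ereal \<epsilon>"
      using 0 by (cases "X (d 0) x") (auto simp: min_def)
  qed
  then show ?case using d by auto
next
  case (Suc n)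
  obtain i where i: "i \<in> I" "AE x in M. \<forall>k\<le>n. min (ereal K) (X (d k) x) \<le> X i x + ereal (\<epsilon> / 2)"
    using Suc.IH[of "\<epsilon> / 2"] Suc.prems by auto
  obtain j where j: "j \<in> I" "AE x in M.
      max (min (ereal K) (X i x)) (min (ereal K) (X (d (Suc n)) x)) - ereal (\<epsilon> / 2) \<le> X j x"
    using lattice[of "\<epsilon> / 2" K i "d (Suc n)"] Suc.prems \<open>0 < K\<close> i(1) d by auto
  have "AE x in M. \<forall>k\<le>Suc n. min (ereal K) (X (d k) x) \<le> X j x + ereal \<epsilon>"
    using i(2) j(2)
  proof eventually_elim
    fix x
    assume i: "\<forall>k\<le>n. min (ereal K) (X (d k) x) \<le> X i x + ereal (\<epsilon> / 2)"
      and j: "max (min (ereal K) (X i x)) (min (ereal K) (X (d (Suc n)) x)) - ereal (\<epsilon> / 2) \<le> X j x"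
    \<comment> \<open>If \<open>a\<close> is at most the cap, the two half errors add up; if it is
      above, \<open>b\<close> is already within half an error of \<open>K\<close>, which bounds the
      left side.\<close>
    have arith: "min (ereal K) c \<le> b + ereal \<epsilon>"
      if "min (ereal K) c \<le> a + ereal (\<epsilon> / 2)" "min (ereal K) a - ereal (\<epsilon> / 2) \<le> b" for a b c
      using that Suc.prems by (cases a; cases b; cases c) (auto simp: min_def split: if_splits)
    have le_add: "min (ereal K) a \<le> a + ereal (\<epsilon> / 2)" for a
      using Suc.prems by (cases a) (auto simp: min_def)
    have "min (ereal K) (X i x) - ereal (\<epsilon> / 2) \<le> X j x"
      by (rule order_trans[OF ereal_minus_mono[OF max.cobounded1 order_refl] j])
    moreover have "min (ereal K) (X (d (Suc n)) x) - ereal (\<epsilon> / 2) \<le> X j x"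
      by (rule order_trans[OF ereal_minus_mono[OF max.cobounded2 order_refl] j])
    ultimately show "\<forall>k\<le>Suc n. min (ereal K) (X (d k) x) \<le> X j x + ereal \<epsilon>"
      using i arith[of "X (d (Suc n)) x" "X (d (Suc n)) x" "X j x"] arith[of _ "X i x" "X j x"] le_add
      by (auto simp: le_Suc_eq)
  qed
  with j(1) show ?case by blast
qed

text \<open>The capped finite maxima \<open>W n\<close> increase to a function above
  \<open>Y\<close>. Each is dominated, up to a small error, by a single member of the family, so
  monotone convergence carries the bound to \<open>Y\<close>.\<close>

lemma expectation_esssup_le:
  fixes X :: "'i \<Rightarrow> 'w \<Rightarrow> ereal"
  assumes M: "prob_space M" and X: "\<And>i. i \<in> I \<Longrightarrow> X i \<in> borel_measurable M"
    and fin: "\<And>i. i \<in> I \<Longrightarrow> neg_integral M (X i) < \<infinity>"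
    and Y: "is_esssup M I X Y" and "I \<noteq> {}"
    and lattice: "\<And>\<epsilon> K i j. 0 < \<epsilon> \<Longrightarrow> 0 < K \<Longrightarrow> i \<in> I \<Longrightarrow> j \<in> I \<Longrightarrow> \<exists>k\<in>I. AE x in M.
      max (min (ereal K) (X i x)) (min (ereal K) (X j x)) - ereal \<epsilon> \<le> X k x"
    and A: "A \<in> sets M"
  shows "ereal_expectation (on_event M A) Y \<le> (SUP i\<in>I. ereal_expectation (on_event M A) (X i))"
proof -
  interpret prob_space M by (rule M)
  let ?N = "on_event M A" and ?s = "SUP i\<in>I. ereal_expectation (on_event M A) (X i)"
  obtain d :: "nat \<Rightarrow> 'i" where d: "range d \<subseteq> I" "AE x in M. Y x \<le> (SUP n. X (d n) x)"
    using is_esssup_le_countable_SUP[OF finite_measure_axioms X Y \<open>I \<noteq> {}\<close>] .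
  have Xd[measurable]: "X (d n) \<in> borel_measurable M" for n using d X by auto
  \<comment> \<open>The cap and the number of members grow together; \<open>Suc n\<close> keeps the
    cap positive already at \<open>n = 0\<close>, as \<open>lattice\<close> demands.\<close>
  define W where "W n x = (SUP k\<in>{..n}. min (ereal (real (Suc n))) (X (d k) x))" for n x
  have W_meas[measurable]: "W n \<in> borel_measurable M" for n
    unfolding W_def by measurable
  have W_mono: "incseq W"
    unfolding incseq_def le_fun_def W_def by (auto intro!: SUP_mono' SUP_subset_mono min.mono)
  have W_sup: "(SUP n. X (d n) x) \<le> (SUP n. W n x)" for x
  proof (rule SUP_least)
    fix k
    show "X (d k) x \<le> (SUP n. W n x)"
    proof (rule le_SUP_iff[THEN iffD2], intro allI impI)
      fix y assume y: "y < X (d k) x"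
      \<comment> \<open>\<open>y\<close> lies below some value and hence below
        \<open>\<infinity>\<close>; an index beyond both \<open>m\<close> and \<open>k\<close> puts
        the cap above \<open>y\<close> and includes member \<open>k\<close>.\<close>
      then obtain m where m: "y < ereal (real m)"
        using less_PInf_Ex_of_nat[of y] by (auto simp: less_ereal.simps dest: less_le_trans[of _ _ \<infinity>])
      let ?n = "max m k"
      have "y < min (ereal (real (Suc ?n))) (X (d k) x)"
        using y m by (auto simp: min_less_iff_conj intro: less_le_trans)
      also have "\<dots> \<le> W ?n x" unfolding W_def by (intro SUP_upper) auto
      finally show "\<exists>n\<in>UNIV. y < W n x" by blast
    qed
  qed
  \<comment> \<open>Monotone convergence needs a first term with finite negative part; capping at 1
    leaves the negative part of \<open>X (d 0)\<close> unchanged.\<close>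
  have W0: "neg_integral ?N (W 0) < \<infinity>"
  proof -
    have "neg_integral ?N (W 0) \<le> neg_integral M (W 0)"
      by (rule neg_integral_on_event_le[OF A W_meas])
    also have "\<dots> \<le> neg_integral M (X (d 0))"
      unfolding neg_integral_def W_def
    proof (rule nn_integral_mono)
      fix x
      show "e2ennreal (- (SUP k\<in>{..0}. min (ereal (real (Suc 0))) (X (d k) x))) \<le> e2ennreal (- X (d 0) x)"
        by (cases "1 \<le> X (d 0) x") (simp_all add: min_def e2ennreal_neg one_ereal_def[symmetric])
    qed
    finally show ?thesis using fin[of "d 0"] d(1) by (auto intro: le_less_trans)
  qed
  have W_le: "ereal_expectation ?N (W n) \<le> ?s" for n
  proof (rule ereal_le_epsilon2)
    fix e :: real assume e: "0 < e"
    \<comment> \<open>Half of \<open>e\<close>, because \<open>ereal_expectation_le_add\<close>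
      doubles the error.\<close>
    obtain i where i: "i \<in> I" "AE x in M. \<forall>k\<le>n. min (ereal (real (Suc n))) (X (d k) x) \<le> X i x + ereal (e / 2)"
      using lattice_finite_family[OF lattice d(1), of "real (Suc n)" "e / 2"] e by auto
    have [measurable]: "X i \<in> borel_measurable M" by (rule X[OF i(1)])
    have "AE x in ?N. W n x \<le> X i x + ereal (e / 2)"
      using i(2) by (intro AE_on_event[OF A]) (auto simp: W_def elim!: eventually_mono intro!: SUP_least)
    then have "ereal_expectation ?N (W n) \<le> ereal_expectation ?N (X i) + ereal (2 * (e / 2))"
      using e A fin[OF i(1)] neg_integral_on_event_le[OF A X[OF i(1)]]
      by (intro ereal_expectation_le_add) (simp_all add: emeasure_on_event_space[simplified] emeasure_le_1)
    also have "\<dots> \<le> ?s + ereal e"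
      using i(1) by (intro add_mono SUP_upper) auto
    finally show "ereal_expectation ?N (W n) \<le> ?s + ereal e" .
  qed
  have "ereal_expectation ?N Y \<le> ereal_expectation ?N (\<lambda>x. SUP n. W n x)"
    using d(2) W_sup by (intro ereal_expectation_mono_AE AE_on_event[OF A]) (auto elim!: eventually_mono intro: order_trans)
  also have "\<dots> \<le> ?s"
    using W_le by (intro LIMSEQ_le_const2[OF ereal_expectation_LIMSEQ[OF W_mono _ W0]]) auto
  finally show ?thesis .
qed

section \<open>Limits of uniformly integrable sequences\<close>

text \<open>Splitting \<open>f = (K + (f - K)\<^sup>+) - (K - f)\<^sup>+\<close> makes Fatou's lemma applicable to \<open>(K - f)\<^sup>+\<close>, while
  uniform integrability controls \<open>(f - K)\<^sup>+\<close>.\<close>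

lemma ereal_expectation_truncate:
  fixes f :: "'w \<Rightarrow> ereal"
  assumes M: "prob_space M" and [measurable]: "f \<in> borel_measurable M"
    and fin: "neg_integral M f < \<infinity>" and K: "0 \<le> K"
  shows "(\<integral>\<^sup>+ x. e2ennreal (ereal K - f x) \<partial>M) < \<infinity>"
    and "ereal_expectation M f =
      enn2ereal (ennreal K + (\<integral>\<^sup>+ x. e2ennreal (f x - ereal K) \<partial>M))
      - enn2ereal (\<integral>\<^sup>+ x. e2ennreal (ereal K - f x) \<partial>M)"
proof -
  interpret prob_space M by (rule M)
  have "e2ennreal (ereal K - y) \<le> ennreal K + e2ennreal (- y)" for y
    using K by (cases y) (auto simp: e2ennreal_neg ennreal_plus_if intro: ennreal_leI)
  then have "(\<integral>\<^sup>+ x. e2ennreal (ereal K - f x) \<partial>M) \<le> (\<integral>\<^sup>+ x. ennreal K + e2ennreal (- f x) \<partial>M)"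
    by (intro nn_integral_mono)
  also have "\<dots> = ennreal K + neg_integral M f"
    unfolding neg_integral_def by (subst nn_integral_add) (auto simp: emeasure_space_1)
  finally show int: "(\<integral>\<^sup>+ x. e2ennreal (ereal K - f x) \<partial>M) < \<infinity>"
    using fin by (auto intro: le_less_trans)
  have "y = enn2ereal (ennreal K + e2ennreal (y - ereal K)) - enn2ereal (e2ennreal (ereal K - y))" for y
    using K by (cases y; cases "y \<le> ereal K")
      (auto simp: e2ennreal_neg plus_ennreal.rep_eq zero_ennreal.rep_eq ennreal_neg enn2ereal_e2ennreal)
  then have "ereal_expectation M f = ereal_expectation M
      (\<lambda>x. enn2ereal (ennreal K + e2ennreal (f x - ereal K)) - enn2ereal (e2ennreal (ereal K - f x)))"
    by simp
  also have "\<dots> = enn2ereal (\<integral>\<^sup>+ x. ennreal K + e2ennreal (f x - ereal K) \<partial>M)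
      - enn2ereal (\<integral>\<^sup>+ x. e2ennreal (ereal K - f x) \<partial>M)"
    using int by (intro ereal_expectation_diff) auto
  also have "(\<integral>\<^sup>+ x. ennreal K + e2ennreal (f x - ereal K) \<partial>M)
      = ennreal K + (\<integral>\<^sup>+ x. e2ennreal (f x - ereal K) \<partial>M)"
    by (subst nn_integral_add) (auto simp: emeasure_space_1)
  finally show "ereal_expectation M f =
      enn2ereal (ennreal K + (\<integral>\<^sup>+ x. e2ennreal (f x - ereal K) \<partial>M))
      - enn2ereal (\<integral>\<^sup>+ x. e2ennreal (ereal K - f x) \<partial>M)" .
qed

text \<open>The assumption is \<open>limsup u \<le> y\<close>, phrased by real thresholds. Any
  \<open>c\<close> below the truncated difference is finite, so it converts to the threshold
  \<open>K - c'\<close>, below which \<open>u n\<close> eventually stays.\<close>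

lemma e2ennreal_diff_le_liminf:
  fixes u :: "nat \<Rightarrow> ereal"
  assumes "\<And>r. y < ereal r \<Longrightarrow> \<forall>\<^sub>F n in sequentially. u n < ereal r"
  shows "e2ennreal (ereal K - y) \<le> liminf (\<lambda>n. e2ennreal (ereal K - u n))"
proof (rule le_Liminf_iff[THEN iffD2], intro allI impI)
  fix c assume c: "c < e2ennreal (ereal K - y)"
  have less_iff: "a < e2ennreal z \<longleftrightarrow> enn2ereal a < z" for a z
    by (cases a; cases z) (auto simp: ennreal_less_iff e2ennreal_neg)
  obtain c' where c': "enn2ereal c = ereal c'"
    using c by (cases c) (auto simp: less_top[symmetric])
  have "ereal c' < ereal K - y" using c c' by (simp add: less_iff)
  then have "y < ereal (K - c')" by (cases y) auto
  then have "\<forall>\<^sub>F n in sequentially. u n < ereal (K - c')" by (rule assms)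
  then show "\<forall>\<^sub>F n in sequentially. c < e2ennreal (ereal K - u n)"
  proof eventually_elim
    case (elim n)
    then have "ereal c' < ereal K - u n" by (cases "u n") auto
    then show ?case by (simp add: less_iff c')
  qed
qed

text \<open>The hypothesis \<open>lim\<close> says \<open>limsup f (s n) \<le> Y\<close> a.e.; the indices \<open>s\<close> need not be increasing.\<close>

lemma expectation_limit_le:
  fixes f :: "nat \<Rightarrow> 'w \<Rightarrow> ereal" and s :: "nat \<Rightarrow> nat"
  assumes M: "prob_space M" and UI: "uniformly_integrable M UNIV f"
    and const: "\<And>n. ereal_expectation M (f n) = e"
    and f_fin: "\<And>n. neg_integral M (f n) < \<infinity>"
    and Y[measurable]: "Y \<in> borel_measurable M" and Y_fin: "neg_integral M Y < \<infinity>"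
    and lim: "AE x in M. \<forall>r. Y x < ereal r \<longrightarrow> (\<forall>\<^sub>F n in sequentially. f (s n) x < ereal r)"
  shows "e \<le> ereal_expectation M Y"
proof (rule ereal_le_epsilon2)
  fix \<epsilon> :: real assume "0 < \<epsilon>"
  have f[measurable]: "f n \<in> borel_measurable M" for n
    using UI by (simp add: uniformly_integrable_def)
  let ?D = "\<lambda>K::real. SUP n. \<integral>\<^sup>+ x. e2ennreal \<bar>f n x\<bar> * indicator {x. ereal K \<le> \<bar>f n x\<bar>} x \<partial>M"
  have "(?D \<longlongrightarrow> 0) at_top" using UI by (simp add: uniformly_integrable_def)
  then have "\<forall>\<^sub>F K in at_top. ?D K < ennreal \<epsilon>"
    by (rule order_tendstoD(2)) (use \<open>0 < \<epsilon>\<close> in simp)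
  then have "\<forall>\<^sub>F K in at_top. 0 \<le> K \<and> ?D K < ennreal \<epsilon>"
    using eventually_ge_at_top[of 0] by eventually_elim auto
  then obtain K where K: "0 \<le> K" "?D K < ennreal \<epsilon>"
    by (auto dest: eventually_happens)
  \<comment> \<open>The excess over \<open>K\<close> lives where \<open>\<bar>f n x\<bar>\<close> is
    at least \<open>K\<close>, so uniform integrability makes it small for all \<open>n\<close>
    simultaneously.\<close>
  have tail: "e2ennreal (f n x - ereal K) \<le> e2ennreal \<bar>f n x\<bar> * indicator {x. ereal K \<le> \<bar>f n x\<bar>} x" for n x
    using K(1) by (cases "f n x") (auto simp: e2ennreal_neg ennreal_neg split: split_indicator intro!: ennreal_leI)
  have a: "(\<integral>\<^sup>+ x. e2ennreal (f n x - ereal K) \<partial>M) \<le> ennreal \<epsilon>" for n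
  proof -
    have "(\<integral>\<^sup>+ x. e2ennreal (f n x - ereal K) \<partial>M) \<le> ?D K"
      by (rule SUP_upper2[of n]) (auto intro: nn_integral_mono tail)
    with K(2) show ?thesis by simp
  qed
  note trunc = ereal_expectation_truncate[OF M f f_fin K(1)]
    and truncY = ereal_expectation_truncate[OF M Y Y_fin K(1)]
  \<comment> \<open>With \<open>a\<close> at most \<epsilon> and \<open>b\<close> finite,
    \<open>e' = K + a - b\<close> is a real number, and solving for \<open>b\<close> bounds it by
    \<open>K + \<epsilon> - r\<close>.\<close>
  have arith1: "\<exists>r. e' = ereal r \<and> b \<le> ennreal (K + \<epsilon> - r) \<and> r \<le> K + \<epsilon>"
    if "e' = enn2ereal (ennreal K + a) - enn2ereal b" "a \<le> ennreal \<epsilon>" "b < \<infinity>" for e' a b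
    using that K(1) \<open>0 < \<epsilon>\<close> by (cases a; cases b)
      (auto simp: top_unique plus_ennreal.rep_eq intro!: ennreal_leI)
  obtain r where r: "e = ereal r" "r \<le> K + \<epsilon>"
    using arith1[OF trunc(2) a trunc(1), of 0] const by auto
  have b: "(\<integral>\<^sup>+ x. e2ennreal (ereal K - f n x) \<partial>M) \<le> ennreal (K + \<epsilon> - r)" for n
    using arith1[OF trunc(2) a trunc(1), of n] const r by auto
  \<comment> \<open>Fatou's lemma along the indices \<open>s\<close>: the shortfalls below
    \<open>K\<close> keep their uniform bound in the limit.\<close>
  have "(\<integral>\<^sup>+ x. e2ennreal (ereal K - Y x) \<partial>M)
      \<le> (\<integral>\<^sup>+ x. liminf (\<lambda>n. e2ennreal (ereal K - f (s n) x)) \<partial>M)"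
    using lim by (intro nn_integral_mono_AE) (auto elim!: eventually_mono intro!: e2ennreal_diff_le_liminf)
  also have "\<dots> \<le> liminf (\<lambda>n. \<integral>\<^sup>+ x. e2ennreal (ereal K - f (s n) x) \<partial>M)"
    by (rule nn_integral_liminf) auto
  also have "\<dots> \<le> liminf (\<lambda>n::nat. ennreal (K + \<epsilon> - r))"
    using b by (intro Liminf_mono always_eventually allI)
  also have "\<dots> = ennreal (K + \<epsilon> - r)" by (simp add: Liminf_const)
  finally have bY: "(\<integral>\<^sup>+ x. e2ennreal (ereal K - Y x) \<partial>M) \<le> ennreal (K + \<epsilon> - r)" .
  have arith2: "ereal r \<le> enn2ereal (ennreal K + a) - enn2ereal b + ereal \<epsilon>"
    if "b \<le> ennreal (K + \<epsilon> - r)" for a b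
    using that K(1) r(2) \<open>0 < \<epsilon>\<close> by (cases a; cases b) (auto simp: top_unique plus_ennreal.rep_eq)
  show "e \<le> ereal_expectation M Y + ereal \<epsilon>"
    unfolding r(1) truncY(2) by (rule arith2[OF bY])
qed

text \<open>Borel-Cantelli: \<open>s k\<close> is chosen so that a deviation above
  \<open>1/(k+1)\<close> has probability below \<open>2^-k\<close>, hence almost surely only
  finitely many such deviations occur.\<close>

lemma converges_in_probability_subseq:
  fixes f :: "nat \<Rightarrow> 'w \<Rightarrow> ereal"
  assumes M: "prob_space M" and [measurable]: "\<And>n. f n \<in> borel_measurable M" "Y \<in> borel_measurable M"
    and conv: "converges_in_probability M f Y"
  obtains s :: "nat \<Rightarrow> nat"
  where "AE x in M. \<forall>r. Y x < ereal r \<longrightarrow> (\<forall>\<^sub>F n in sequentially. f (s n) x < ereal r)"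
proof -
  interpret prob_space M by (rule M)
  define B where "B k n = {x \<in> space M. f n x \<noteq> Y x \<and> ereal (1 / real (Suc k)) < \<bar>f n x - Y x\<bar>}" for k n
  have B[measurable]: "B k n \<in> sets M" for k n unfolding B_def by measurable
  have "\<exists>n. measure M (B k n) < (1 / 2) ^ k" for k
  proof -
    have "(\<lambda>n. measure M (B k n)) \<longlonglongrightarrow> 0"
      using conv unfolding converges_in_probability_def B_def by auto
    then have "\<forall>\<^sub>F n in sequentially. measure M (B k n) < (1 / 2) ^ k"
      by (rule order_tendstoD(2)) simp
    then show ?thesis by (auto dest: eventually_happens)
  qed
  then have "\<forall>k. \<exists>n. measure M (B k n) < (1 / 2) ^ k" ..
  from choice[OF this] obtain s where s: "\<forall>k. measure M (B k (s k)) < (1 / 2) ^ k" ..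
  have "AE x in M. \<forall>\<^sub>F k in sequentially. x \<in> space M - B k (s k)"
  proof (rule borel_cantelli_AE1)
    show "summable (\<lambda>k. measure M (B k (s k)))"
    proof (rule summable_comparison_test')
      show "summable (\<lambda>k. (1 / 2) ^ k :: real)" by (rule summable_geometric) simp
      show "norm (measure M (B k (s k))) \<le> (1 / 2) ^ k" if "k \<ge> 0" for k
        using s by (simp add: less_imp_le)
    qed
  qed (simp_all add: less_top[symmetric] B)
  then have "AE x in M. \<forall>r. Y x < ereal r \<longrightarrow> (\<forall>\<^sub>F n in sequentially. f (s n) x < ereal r)"
  proof (eventually_elim, intro allI impI)
    fix x r
    assume ev: "\<forall>\<^sub>F k in sequentially. x \<in> space M - B k (s k)" and Yr: "Y x < ereal r"
    have "\<forall>\<^sub>F k in sequentially. Y x + ereal (1 / real (Suc k)) < ereal r"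
    proof (cases "Y x")
      case (real y)
      have "\<forall>\<^sub>F k in sequentially. 1 / real (Suc k) < r - y"
        using Yr real by (intro order_tendstoD(2)[OF LIMSEQ_Suc[OF lim_1_over_n]]) auto
      then show ?thesis by eventually_elim (simp add: real)
    qed (use Yr in auto)
    with ev show "\<forall>\<^sub>F k in sequentially. f (s k) x < ereal r"
    proof eventually_elim
      case (elim k)
      show ?case
      \<comment> \<open>Equal values are split off because \<open>B\<close> excludes them by
        definition: two equal infinities have difference \<open>\<infinity>\<close> yet count as
        close.\<close>
      proof (cases "f (s k) x = Y x")
        case False
        with elim have "\<bar>f (s k) x - Y x\<bar> \<le> ereal (1 / real (Suc k))"
          by (simp add: B_def not_less)
        then have "f (s k) x \<le> Y x + ereal (1 / real (Suc k))"
          by (cases "f (s k) x"; cases "Y x") auto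
        also have "\<dots> < ereal r" by (rule elim)
        finally show ?thesis .
      qed (use Yr in simp)
    qed
  qed
  then show thesis by (rule that)
qed

section \<open>Trivial and restricted probability laws\<close>

text \<open>Each event \<open>f \<ge> n\<close> has probability 0 or 1. Probability 0 would bound
  the expectation by \<open>n\<close>, so all of them are almost sure.\<close>

lemma AE_infinite_of_trivial:
  fixes f :: "'w \<Rightarrow> ereal"
  assumes M: "prob_space M" and F: "subalgebra M F" and [measurable]: "f \<in> borel_measurable F"
    and triv: "\<And>A. A \<in> sets F \<Longrightarrow> measure M A = 0 \<or> measure M A = 1"
    and inf: "ereal_expectation M f = \<infinity>"
  shows "AE x in M. f x = \<infinity>"
proof -
  interpret prob_space M by (rule M)
  have "AE x in M. ereal (real n) \<le> f x" for n
  proof -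
    let ?A = "{x \<in> space F. ereal (real n) \<le> f x}"
    have AF: "?A \<in> sets F" by measurable
    have sp: "space F = space M" and A: "?A \<in> sets M"
      using F AF unfolding subalgebra_def by blast+
    have "measure M ?A \<noteq> 0"
    proof
      assume "measure M ?A = 0"
      then have "?A \<in> null_sets M" using A by (simp add: null_sets_def emeasure_eq_measure)
      then have "AE x in M. x \<notin> ?A" by (rule AE_not_in)
      then have "AE x in M. f x \<le> ereal (real n)"
        using AE_space by eventually_elim (auto simp: sp)
      then have "ereal_expectation M f \<le> ereal_expectation M (\<lambda>_. ereal (real n))"
        by (rule ereal_expectation_mono_AE)
      with inf show False by (simp add: ereal_expectation_const[OF finite_measure_axioms])
    qed
    then have "prob ?A = 1" using triv[OF AF] by simp
    then have "AE x in M. x \<in> ?A" using A by (simp add: prob_eq_1)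
    then show ?thesis by eventually_elim auto
  qed
  then have "AE x in M. \<forall>n. ereal (real n) \<le> f x" by (simp add: AE_all_countable)
  then show ?thesis
  proof eventually_elim
    case (elim x)
    show ?case
    proof (rule ccontr)
      assume "f x \<noteq> \<infinity>"
      then obtain n where "f x < ereal (real n)" using less_PInf_Ex_of_nat[of "f x"] by auto
      with elim show False by (meson not_le)
    qed
  qed
qed

text \<open>Links the restricted law, under which the essential suprema are taken, with the full
  law, under which the payoffs are averaged.\<close>

lemma expectation_on_event_restr_to_subalg:
  fixes f :: "'w \<Rightarrow> ereal"
  assumes F: "subalgebra M F" and [measurable]: "f \<in> borel_measurable F" "A \<in> sets F"
  shows "ereal_expectation (on_event (restr_to_subalg M F) A) f = ereal_expectation (on_event M A) f"
proof -
  have A: "A \<in> sets M" "A \<in> sets (restr_to_subalg M F)"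
    using F assms(3) by (auto simp: subalgebra_def sets_restr_to_subalg[OF F])
  have "(\<integral>\<^sup>+ x. g x \<partial>on_event (restr_to_subalg M F) A) = (\<integral>\<^sup>+ x. g x \<partial>on_event M A)"
    if [measurable]: "g \<in> borel_measurable F" for g :: "'w \<Rightarrow> ennreal"
    using A measurable_from_subalg[OF F that] measurable_in_subalg[OF F that]
    by (simp add: nn_integral_on_event nn_integral_subalgebra2[OF F])
  then show ?thesis
    by (simp add: ereal_expectation_def neg_integral_def)
qed

lemma neg_integral_restr_to_subalg:
  fixes f :: "'w \<Rightarrow> ereal"
  assumes F: "subalgebra M F" and [measurable]: "f \<in> borel_measurable F"
  shows "neg_integral (restr_to_subalg M F) f = neg_integral M f"
  unfolding neg_integral_def by (rule nn_integral_subalgebra2[OF F]) measurable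

lemma is_esssup_unique:
  assumes "is_esssup M I X Y" "is_esssup M I X Z"
  shows "AE x in M. Y x = Z x"
proof -
  have "AE x in M. Y x \<le> Z x" "AE x in M. Z x \<le> Y x"
    using assms by (auto simp: is_esssup_def)
  then show ?thesis by eventually_elim auto
qed

section \<open>Coherent control systems\<close>

locale coherent_bellman =
  fixes X :: "('c, 'w) control_system"
    and V :: "'c \<Rightarrow> ('c \<Rightarrow> 'w \<Rightarrow> ennreal) \<Rightarrow> 'w \<Rightarrow> ereal"
  assumes coherent: "coherent_control_system X" and bellman: "bellman_system X V"
begin

section \<open>Consequences of the axioms of a coherent control system\<close>

lemma stochastic: "stochastic_control_system X"
  and adaptive: "adaptive_control_dynamics X"
  and stable: "stable_under_stopping X"
  using coherent by (simp_all add: coherent_control_system_def)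

lemma
  assumes "c \<in> controls X"
  shows prob_space_law: "prob_space (law X c)"
    and space_law: "space (law X c) = sample_space X"
    and subalgebra_events: "subalgebra (law X c) (events X c)"
    and neg_integral_reward: "neg_integral (law X c) (reward X c) < \<infinity>"
  using stochastic assms by (simp_all add: stochastic_control_system_def)

lemma
  assumes "c \<in> controls X"
  shows complete_law: "completed X \<Longrightarrow> complete_measure (law X c)"
    and null_sets_info: "completed X \<Longrightarrow> null_sets (law X c) \<subseteq> sets (info X c 0)"
    and subalgebra_info_time: "t \<in> time_set X \<Longrightarrow> subalgebra (events X c) (info X c t)"
    and info_mono: "s \<in> time_set X \<Longrightarrow> t \<in> time_set X \<Longrightarrow> s \<le> t \<Longrightarrow> sets (info X c s) \<subseteq> sets (info X c t)"
    and info_zero_trivial: "A \<in> sets (info X c 0) \<Longrightarrow> measure (law X c) A = 0 \<or> measure (law X c) A = 1"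
proof -
  have "(completed X \<longrightarrow> complete_measure (law X c) \<and> null_sets (law X c) \<subseteq> sets (events X c))
      \<and> (\<forall>t\<in>time_set X. subalgebra (events X c) (info X c t))
      \<and> (\<forall>s\<in>time_set X. \<forall>t\<in>time_set X. s \<le> t \<longrightarrow> sets (info X c s) \<subseteq> sets (info X c t))
      \<and> (\<forall>A\<in>sets (info X c 0). measure (law X c) A = 0 \<or> measure (law X c) A = 1)
      \<and> (completed X \<longrightarrow> null_sets (law X c) \<subseteq> sets (info X c 0))"
    using conjunct1[OF conjunct2[OF stochastic[unfolded stochastic_control_system_def]], THEN bspec, OF assms]
    by (elim conjE, intro conjI)
  then show
    "completed X \<Longrightarrow> complete_measure (law X c)"
    "completed X \<Longrightarrow> null_sets (law X c) \<subseteq> sets (info X c 0)"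
    "t \<in> time_set X \<Longrightarrow> subalgebra (events X c) (info X c t)"
    "s \<in> time_set X \<Longrightarrow> t \<in> time_set X \<Longrightarrow> s \<le> t \<Longrightarrow> sets (info X c s) \<subseteq> sets (info X c t)"
    "A \<in> sets (info X c 0) \<Longrightarrow> measure (law X c) A = 0 \<or> measure (law X c) A = 1"
    by simp_all
qed

lemma reward_measurable:
  assumes "c \<in> controls X"
  shows "reward X c \<in> borel_measurable (law X c)"
  using stochastic assms by (auto simp: stochastic_control_system_def intro: measurable_from_subalg)

lemma
  assumes "S \<in> control_times X"
  shows control_time: "control_time X S"
    and reach_partition: "partition_on (controls X) ((\<lambda>c. reach X c S) ` controls X)"
  using adaptive assms by (simp_all add: adaptive_control_dynamics_def)

lemma
  assumes "c \<in> controls X" "S \<in> control_times X"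
  shows reach_controls: "reach X c S \<subseteq> controls X"
    and reach_refl: "c \<in> reach X c S"
    and reach_infinity: "surely X c (\<lambda>\<omega>. S c \<omega> = \<infinity>) \<Longrightarrow> reach X c S = {c}"
    and reach_zero: "surely X c (\<lambda>\<omega>. S c \<omega> = 0) \<Longrightarrow> reach X c S = controls X"
  using adaptive assms by (simp_all add: adaptive_control_dynamics_def)

lemma reach_antimono:
  assumes "c \<in> controls X" "S \<in> control_times X" "T \<in> control_times X" "precedes X c S T"
  shows "reach X c T \<subseteq> reach X c S"
  using adaptive assms by (simp add: adaptive_control_dynamics_def)

lemma reach_equiv_at:
  assumes "c \<in> controls X" "S \<in> control_times X" "d \<in> reach X c S"
  shows "d \<in> controls X" "equiv_at X S c d"
  using reach_controls[OF assms(1,2)] reach_refl[OF assms(1,2)] assms by (auto simp: equiv_at_def)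

text \<open>\<open>equiv_at\<close> places both controls in a common class
  \<open>reach X e S\<close>; each control lies in its own class, and classes of a partition that
  meet coincide.\<close>

lemma equiv_at_reach_eq:
  assumes S: "S \<in> control_times X" and c: "c \<in> controls X" and d: "d \<in> controls X"
    and eq: "equiv_at X S c d"
  shows "reach X d S = reach X c S"
proof -
  obtain e where e: "e \<in> controls X" "c \<in> reach X e S" "d \<in> reach X e S"
    using eq by (auto simp: equiv_at_def)
  have "reach X a S = reach X e S" if "a \<in> controls X" "a \<in> reach X e S" for a
  proof (rule ccontr)
    assume "reach X a S \<noteq> reach X e S"
    then have "reach X a S \<inter> reach X e S = {}"
      using partition_onD2[OF reach_partition[OF S]] that(1) e(1) by (auto simp: disjoint_def)
    then show False using reach_refl[OF that(1) S] that(2) by auto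
  qed
  then show ?thesis using c d e by simp
qed

section \<open>Transfer between the laws of equivalent controls\<close>

lemma
  assumes c: "c \<in> controls X" and S: "S \<in> control_times X" and d: "d \<in> reach X c S"
  shows sets_info_at_reach: "sets (info_at X d S) = sets (info_at X c S)"
    and law_at_reach: "law_at X d S = law_at X c S"
proof -
  have "sets (info_at X c S) = sets (info_at X d S) \<and> law_at X c S = law_at X d S"
    using stable reach_equiv_at[OF assms] c S unfolding stable_under_stopping_def by blast
  then show "sets (info_at X d S) = sets (info_at X c S)" "law_at X d S = law_at X c S" by auto
qed

lemma subalgebra_info:
  assumes "c \<in> controls X" "S \<in> control_times X"
  shows "subalgebra (law X c) (info_at X c S)"
  using subalgebra_info_at[OF stochastic assms(1) control_time[OF assms(2)]] .

lemma finite_measure_subalgebra_info: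
  assumes "c \<in> controls X" "S \<in> control_times X"
  shows "finite_measure_subalgebra (law X c) (info_at X c S)"
proof -
  interpret prob_space "law X c" by (rule prob_space_law[OF assms(1)])
  show ?thesis by unfold_locales (rule subalgebra_info[OF assms])
qed

lemma prob_space_law_at:
  assumes "c \<in> controls X" "S \<in> control_times X"
  shows "prob_space (law_at X c S)"
  unfolding law_at_def using prob_space_restr_to_subalg subalgebra_info[OF assms] prob_space_law[OF assms(1)] .

lemma measurable_law_at_iff:
  assumes "c \<in> controls X" "S \<in> control_times X"
  shows "f \<in> measurable (law_at X c S) N \<longleftrightarrow> f \<in> measurable (info_at X c S) N"
  by (rule measurable_cong_sets[THEN arg_cong[where f = "\<lambda>A. f \<in> A"]])
    (simp_all add: law_at_def sets_restr_to_subalg[OF subalgebra_info[OF assms]])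

lemma sets_law_at:
  assumes "c \<in> controls X" "S \<in> control_times X"
  shows "sets (law_at X c S) = sets (info_at X c S)"
  unfolding law_at_def by (rule sets_restr_to_subalg[OF subalgebra_info[OF assms]])

text \<open>Controls in one class share the restricted law, so an exceptional set that is null for
  it is null under the full law of each of them.\<close>

lemma AE_law_at:
  assumes "c \<in> controls X" "S \<in> control_times X" "d \<in> reach X c S" "AE \<omega> in law_at X c S. P \<omega>"
  shows "AE \<omega> in law X d. P \<omega>"
proof (rule AE_restr_to_subalg[OF subalgebra_info[OF reach_equiv_at(1)[OF assms(1-3)] assms(2)]])
  show "AE \<omega> in restr_to_subalg (law X d) (info_at X d S). P \<omega>"
    using assms(4) unfolding law_at_reach[OF assms(1-3), symmetric] unfolding law_at_def .
qed

text \<open>Measurability of \<open>P\<close> is the point: the exceptional set has to be an event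
  of the smaller \<sigma>-field.\<close>

lemma AE_law_atI:
  assumes "c \<in> controls X" "S \<in> control_times X"
    and "AE \<omega> in law X c. P \<omega>" "Measurable.pred (info_at X c S) P"
  shows "AE \<omega> in law_at X c S. P \<omega>"
  unfolding law_at_def
  by (rule AE_restr_to_subalg2[OF subalgebra_info[OF assms(1,2)] assms(3,4)])

lemma expectation_law_at:
  assumes "c \<in> controls X" "S \<in> control_times X"
    and "f \<in> borel_measurable (info_at X c S)" "A \<in> sets (info_at X c S)"
  shows "ereal_expectation (on_event (law_at X c S) A) f = ereal_expectation (on_event (law X c) A) f"
  unfolding law_at_def
  by (rule expectation_on_event_restr_to_subalg[OF subalgebra_info[OF assms(1,2)] assms(3,4)])

lemma measurable_info_reach:
  assumes "c \<in> controls X" "S \<in> control_times X" "d \<in> reach X c S"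
  shows "f \<in> measurable (info_at X d S) N \<longleftrightarrow> f \<in> measurable (info_at X c S) N"
  using measurable_law_at_iff[OF reach_equiv_at(1)[OF assms] assms(2), of f N]
  unfolding law_at_reach[OF assms] measurable_law_at_iff[OF assms(1,2)] by (rule sym)

lemma payoff_measurable:
  assumes "c \<in> controls X" "S \<in> control_times X" "d \<in> reach X c S"
  shows "payoff X d S \<in> borel_measurable (info_at X c S)"
  unfolding measurable_info_reach[OF assms, symmetric] payoff_def by measurable

lemma bellman_esssup:
  assumes "c \<in> controls X" "S \<in> control_times X"
  shows "is_esssup (law_at X c S) (reach X c S) (\<lambda>d. payoff X d S) (V c S)"
  using bellman assms by (simp add: bellman_system_def)

lemma V_measurable:
  assumes "c \<in> controls X" "S \<in> control_times X"
  shows "V c S \<in> borel_measurable (info_at X c S)"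
  using bellman_esssup[OF assms] unfolding is_esssup_def measurable_law_at_iff[OF assms] by (rule conjunct1)

lemma payoff_le_V:
  assumes "c \<in> controls X" "S \<in> control_times X" "d \<in> reach X c S"
  shows "AE \<omega> in law X c. payoff X d S \<omega> \<le> V c S \<omega>"
  using bellman_esssup[OF assms(1,2)] assms(3)
  by (intro AE_law_at[OF assms(1,2) reach_refl[OF assms(1,2)]]) (auto simp: is_esssup_def)

text \<open>Stability under stopping: both sides are expectations under the common restricted
  law.\<close>

lemma expectation_reach:
  assumes "c \<in> controls X" "S \<in> control_times X" "d \<in> reach X c S"
    and f: "f \<in> borel_measurable (info_at X c S)" and A: "A \<in> sets (info_at X c S)"
  shows "ereal_expectation (on_event (law X d) A) f = ereal_expectation (on_event (law X c) A) f"
  using expectation_law_at[OF assms(1,2) f A]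
    expectation_law_at[OF reach_equiv_at(1)[OF assms(1-3)] assms(2), of f A] f A
    law_at_reach[OF assms(1-3)] measurable_info_reach[OF assms(1-3)] sets_info_at_reach[OF assms(1-3)]
  by simp

text \<open>The payoff of \<open>d\<close> is first moved to the law of \<open>d\<close>, where
  conditioning does not enlarge the negative part of its reward.\<close>

lemma neg_integral_payoff:
  assumes "c \<in> controls X" "S \<in> control_times X" "d \<in> reach X c S"
  shows "neg_integral (law_at X c S) (payoff X d S) < \<infinity>"
proof -
  have d: "d \<in> controls X" by (rule reach_equiv_at(1)[OF assms])
  interpret finite_measure_subalgebra "law X d" "info_at X d S"
    by (rule finite_measure_subalgebra_info[OF d assms(2)])
  have "neg_integral (law_at X c S) (payoff X d S) = neg_integral (law X d) (payoff X d S)"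
    unfolding law_at_reach[OF assms, symmetric]
    unfolding law_at_def payoff_def by (rule neg_integral_restr_to_subalg[OF subalg]) measurable
  also have "\<dots> \<le> neg_integral (law X d) (reward X d)"
    unfolding payoff_def by (rule neg_integral_ereal_cond_exp_le[OF reward_measurable[OF d]])
  finally show ?thesis using neg_integral_reward[OF d] by (rule le_less_trans)
qed

lemma neg_integral_law_payoff:
  assumes "c \<in> controls X" "S \<in> control_times X"
  shows "neg_integral (law X c) (payoff X c S) < \<infinity>"
  using neg_integral_payoff[OF assms reach_refl[OF assms]] neg_integral_restr_to_subalg[OF subalgebra_info[OF assms]
      payoff_measurable[OF assms reach_refl[OF assms]]]
  by (simp add: law_at_def)

text \<open>\<open>V c S\<close> dominates the payoff of \<open>c\<close> itself, which has a finite
  negative integral.\<close>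

lemma neg_integral_V:
  assumes "c \<in> controls X" "S \<in> control_times X"
  shows "neg_integral (law X c) (V c S) < \<infinity>"
  using neg_integral_mono_AE[OF payoff_le_V[OF assms reach_refl[OF assms]]] neg_integral_law_payoff[OF assms]
  by (rule le_less_trans)

lemma V_law_measurable:
  assumes "c \<in> controls X" "S \<in> control_times X"
  shows "V c S \<in> borel_measurable (law X c)"
  by (rule measurable_from_subalg[OF subalgebra_info[OF assms] V_measurable[OF assms]])

lemma payoff_law_measurable:
  assumes "c \<in> controls X" "S \<in> control_times X"
  shows "payoff X c S \<in> borel_measurable (law X c)"
  by (rule measurable_from_subalg[OF subalgebra_info[OF assms] payoff_measurable[OF assms reach_refl[OF assms]]])

text \<open>The law of \<open>c\<close> is exchanged for that of \<open>d\<close> on their common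
  information; the averaging property of conditional expectation then removes the
  conditioning.\<close>

lemma expectation_payoff:
  assumes "c \<in> controls X" "S \<in> control_times X" "d \<in> reach X c S" and A: "A \<in> sets (info_at X c S)"
  shows "ereal_expectation (on_event (law X c) A) (payoff X d S)
    = ereal_expectation (on_event (law X d) A) (reward X d)"
proof -
  have d: "d \<in> controls X" by (rule reach_equiv_at(1)[OF assms(1-3)])
  interpret finite_measure_subalgebra "law X d" "info_at X d S"
    by (rule finite_measure_subalgebra_info[OF d assms(2)])
  have "ereal_expectation (on_event (law X c) A) (payoff X d S)
    = ereal_expectation (on_event (law X d) A) (payoff X d S)"
    by (rule expectation_reach[OF assms(1-3) payoff_measurable[OF assms(1-3)] A, symmetric])
  also have "\<dots> = ereal_expectation (on_event (law X d) A) (reward X d)"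
    unfolding payoff_def
    using A sets_info_at_reach[OF assms(1-3)] reward_measurable[OF d] neg_integral_reward[OF d]
    by (intro expectation_on_event_ereal_cond_exp) auto
  finally show ?thesis .
qed

lemma space_in_info:
  assumes "c \<in> controls X" "S \<in> control_times X"
  shows "space (law X c) \<in> sets (info_at X c S)"
  using subalgebra_info[OF assms] by (metis sets.top subalgebra_def)

lemma expectation_payoff_space:
  assumes "c \<in> controls X" "S \<in> control_times X" "d \<in> reach X c S"
  shows "ereal_expectation (law X c) (payoff X d S) = expected_reward X d"
proof -
  have d: "d \<in> controls X" by (rule reach_equiv_at(1)[OF assms(1-3)])
  have "payoff X d S \<in> borel_measurable (law X c)"
    by (rule measurable_from_subalg[OF subalgebra_info[OF assms(1,2)] payoff_measurable[OF assms]])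
  then have "ereal_expectation (law X c) (payoff X d S)
      = ereal_expectation (on_event (law X d) (space (law X c))) (reward X d)"
    using expectation_payoff[OF assms space_in_info[OF assms(1,2)]]
    by (simp only: ereal_expectation_on_space)
  also have "space (law X c) = space (law X d)" by (simp add: space_law assms(1) d)
  finally show ?thesis
    by (simp only: ereal_expectation_on_space[OF reward_measurable[OF d]] expected_reward_def)
qed

section \<open>Information at ordered control times and at time 0\<close>

lemma zero_in_time_set: "0 \<in> time_set X"
proof -
  have "(0 :: ennreal) \<in> range of_nat" by (metis of_nat_0 rangeI)
  moreover have "(0 :: ennreal) \<in> {t. t < \<infinity>}" by simp
  ultimately show ?thesis
    using conjunct1[OF stochastic[unfolded stochastic_control_system_def]] by (elim disjE) simp_all
qed

lemma AE_of_surely: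
  assumes "c \<in> controls X" "surely X c Q"
  shows "AE \<omega> in law X c. Q \<omega>"
proof (cases "completed X")
  case False
  then show ?thesis using assms(2) by (intro AE_I2) (simp add: surely_def space_law[OF assms(1)])
qed (use assms(2) in \<open>simp add: surely_def\<close>)

text \<open>If \<open>S \<le> T\<close>, then intersecting \<open>A\<close> with
  \<open>T \<le> t\<close> gives the same set as intersecting it with both \<open>S \<le> t\<close>
  and \<open>T \<le> t\<close>. In the completed setting this holds up to a null set, which the
  information already contains.\<close>

lemma info_at_mono:
  assumes c: "c \<in> controls X" and S: "S \<in> control_times X" and T: "T \<in> control_times X"
    and le: "precedes X c S T"
  shows "sets (info_at X c S) \<subseteq> sets (info_at X c T)"
proof
  fix A assume A: "A \<in> sets (info_at X c S)"
  have le_c: "surely X c (\<lambda>\<omega>. S c \<omega> \<le> T c \<omega>)"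
    using le reach_refl[OF c T] by (auto simp: precedes_def)
  have AS: "A \<in> sets (info_infinity X c)" "\<And>t. t \<in> time_set X \<Longrightarrow> {\<omega>\<in>A. S c \<omega> \<le> t} \<in> sets (info X c t)"
    using A by (simp_all add: sets_info_at[OF stochastic c control_time[OF S]])
  have A_sub: "A \<subseteq> sample_space X"
    using sets.sets_into_space[OF AS(1)] by (simp add: info_infinity_def space_measure_of_conv)
  have "{\<omega>\<in>A. T c \<omega> \<le> t} \<in> sets (info X c t)" if t: "t \<in> time_set X" for t
  proof -
    let ?B = "{\<omega>\<in>A. S c \<omega> \<le> t} \<inter> {\<omega>\<in>sample_space X. T c \<omega> \<le> t}"
    have B: "?B \<in> sets (info X c t)"
      using AS(2)[OF t] control_time[OF T] c t by (auto simp: control_time_def)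
    show ?thesis
    proof (cases "completed X")
      case False
      then have "{\<omega>\<in>A. T c \<omega> \<le> t} = ?B"
        using le_c A_sub by (auto simp: surely_def intro: order_trans)
      with B show ?thesis by simp
    next
      case True
      \<comment> \<open>Null sets are known at time 0 and stay known at every later time.\<close>
      have null: "null_sets (law X c) \<subseteq> sets (info X c t)"
        using null_sets_info[OF c True] info_mono[OF c zero_in_time_set t] by auto
      \<comment> \<open>The discrepancy between the two sets; it lies where \<open>S \<le> T\<close>
        fails and is measurable by completeness.\<close>
      let ?N = "{\<omega>\<in>A. T c \<omega> \<le> t \<and> \<not> S c \<omega> \<le> t}"
      obtain N where N: "N \<in> null_sets (law X c)"
        "\<And>\<omega>. \<omega> \<in> space (law X c) - N \<Longrightarrow> S c \<omega> \<le> T c \<omega>"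
        using AE_E3[OF AE_of_surely[OF c le_c]] by blast
      have "?N \<subseteq> N"
        using N(2) A_sub unfolding space_law[OF c] by (blast intro: order_trans)
      then have "?N \<in> null_sets (law X c)"
        using complete_measure.complete2[OF complete_law[OF c True] _ N(1)] by blast
      then have "?N \<in> sets (info X c t)" using null by blast
      moreover have "{\<omega>\<in>A. T c \<omega> \<le> t} = ?B \<union> ?N" using A_sub by auto
      ultimately show ?thesis using B by (simp only: sets.Un)
    qed
  qed
  with AS(1) show "A \<in> sets (info_at X c T)"
    by (simp add: sets_info_at[OF stochastic c control_time[OF T]])
qed

text \<open>\<open>A\<close> agrees almost surely with its part where \<open>Z \<le> 0\<close>, an
  event of the trivial \<sigma>-field \<open>info X c 0\<close>.\<close>

lemma info_at_zero_trivial: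
  assumes c: "c \<in> controls X" and Z: "Z \<in> control_times X" and zero: "surely X c (\<lambda>\<omega>. Z c \<omega> = 0)"
    and A: "A \<in> sets (info_at X c Z)"
  shows "measure (law X c) A = 0 \<or> measure (law X c) A = 1"
proof -
  note sub = subalgebra_events[OF c] subalgebra_info_time[OF c zero_in_time_set]
  have B: "{\<omega>\<in>A. Z c \<omega> \<le> 0} \<in> sets (info X c 0)"
    using A zero_in_time_set unfolding sets_info_at[OF stochastic c control_time[OF Z]] by blast
  then have BM: "{\<omega>\<in>A. Z c \<omega> \<le> 0} \<in> sets (law X c)"
    using sub unfolding subalgebra_def by blast
  have AM: "A \<in> sets (law X c)"
    using A subalgebra_info[OF c Z] unfolding subalgebra_def by blast
  have "measure (law X c) A = measure (law X c) {\<omega>\<in>A. Z c \<omega> \<le> 0}"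
    by (rule measure_eq_AE[OF _ AM BM]) (use AE_of_surely[OF c zero] in \<open>auto elim: eventually_mono\<close>)
  with info_zero_trivial[OF c B] show ?thesis by simp
qed

section \<open>Bounds on the expectation of V\<close>

lemma expectation_V_le_SUP:
  assumes lattice: "weak_upwards_lattice X"
    and c: "c \<in> controls X" and T: "T \<in> control_times X" and A: "A \<in> sets (info_at X c T)"
  shows "ereal_expectation (on_event (law X c) A) (V c T)
    \<le> (SUP d\<in>reach X c T. ereal_expectation (on_event (law X d) A) (reward X d))"
proof -
  let ?I = "reach X c T"
  have "ereal_expectation (on_event (law_at X c T) A) (V c T)
    \<le> (SUP d\<in>?I. ereal_expectation (on_event (law_at X c T) A) (payoff X d T))"
  proof (rule expectation_esssup_le[OF prob_space_law_at[OF c T] _ _ bellman_esssup[OF c T]])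
    show "?I \<noteq> {}" using reach_refl[OF c T] by auto
    show "A \<in> sets (law_at X c T)" using A by (simp add: sets_law_at[OF c T])
    fix d assume d: "d \<in> ?I"
    show "payoff X d T \<in> borel_measurable (law_at X c T)"
      using payoff_measurable[OF c T d] by (simp add: measurable_law_at_iff[OF c T])
    show "neg_integral (law_at X c T) (payoff X d T) < \<infinity>" by (rule neg_integral_payoff[OF c T d])
  next
    fix \<epsilon> K :: real and i j assume *: "0 < \<epsilon>" "0 < K" "i \<in> ?I" "j \<in> ?I"
    then obtain k where k: "k \<in> ?I" "AE \<omega> in law X c.
      max (min (ereal K) (payoff X i T \<omega>)) (min (ereal K) (payoff X j T \<omega>)) - ereal \<epsilon> \<le> payoff X k T \<omega>"
      using lattice c T unfolding weak_upwards_lattice_def by blast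
    \<comment> \<open>The lattice inequality is given under the full law; measurability of the three
      payoffs with respect to the information at \<open>T\<close> carries it to the restricted
      law.\<close>
    note [measurable] = payoff_measurable[OF c T *(3)] payoff_measurable[OF c T *(4)] payoff_measurable[OF c T k(1)]
    show "\<exists>k\<in>?I. AE \<omega> in law_at X c T.
      max (min (ereal K) (payoff X i T \<omega>)) (min (ereal K) (payoff X j T \<omega>)) - ereal \<epsilon> \<le> payoff X k T \<omega>"
      using k by (intro bexI[of _ k] AE_law_atI[OF c T]) (simp_all, measurable)
  qed
  also have "(SUP d\<in>?I. ereal_expectation (on_event (law_at X c T) A) (payoff X d T))
    = (SUP d\<in>?I. ereal_expectation (on_event (law X d) A) (reward X d))"
    using expectation_law_at[OF c T payoff_measurable[OF c T] A] expectation_payoff[OF c T _ A]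
    by (intro SUP_cong) auto
  finally show ?thesis unfolding expectation_law_at[OF c T V_measurable[OF c T] A] .
qed

text \<open>The opposite bound: \<open>V c S\<close> dominates the payoff of \<open>d\<close>, whose
  average over \<open>A\<close> is that of the reward of \<open>d\<close>.\<close>

lemma expectation_reward_le_V:
  assumes c: "c \<in> controls X" and S: "S \<in> control_times X" and d: "d \<in> reach X c S"
    and A: "A \<in> sets (info_at X c S)"
  shows "ereal_expectation (on_event (law X d) A) (reward X d) \<le> ereal_expectation (on_event (law X c) A) (V c S)"
proof -
  have "A \<in> sets (law X c)" using A subalgebra_info[OF c S] unfolding subalgebra_def by blast
  then show ?thesis
    unfolding expectation_payoff[OF c S d A, symmetric]
    by (intro ereal_expectation_mono_AE AE_on_event payoff_le_V[OF c S d])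
qed

lemma expected_reward_le_V:
  assumes "c \<in> controls X" "S \<in> control_times X" "d \<in> reach X c S"
  shows "expected_reward X d \<le> ereal_expectation (law X c) (V c S)"
  unfolding expectation_payoff_space[OF assms, symmetric]
  by (rule ereal_expectation_mono_AE[OF payoff_le_V[OF assms]])

lemma expectation_V_le_optimal_value:
  assumes lattice: "weak_upwards_lattice X" and c: "c \<in> controls X" and T: "T \<in> control_times X"
  shows "ereal_expectation (law X c) (V c T) \<le> optimal_value X"
proof -
  have "ereal_expectation (law X c) (V c T) = ereal_expectation (on_event (law X c) (space (law X c))) (V c T)"
    by (rule ereal_expectation_on_space[OF V_law_measurable[OF c T], symmetric])
  also have "\<dots> \<le> (SUP d\<in>reach X c T. ereal_expectation (on_event (law X d) (space (law X c))) (reward X d))"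
    by (rule expectation_V_le_SUP[OF lattice c T space_in_info[OF c T]])
  also have "\<dots> = (SUP d\<in>reach X c T. expected_reward X d)"
  proof (intro SUP_cong refl)
    fix d assume "d \<in> reach X c T"
    then have d: "d \<in> controls X" by (rule reach_equiv_at(1)[OF c T])
    have "space (law X c) = space (law X d)" by (simp add: space_law c d)
    then show "ereal_expectation (on_event (law X d) (space (law X c))) (reward X d) = expected_reward X d"
      by (simp add: ereal_expectation_on_space[OF reward_measurable[OF d]] expected_reward_def)
  qed
  also have "\<dots> \<le> optimal_value X"
    unfolding optimal_value_def by (rule SUP_subset_mono[OF reach_controls[OF c T] order_refl])
  finally show ?thesis .
qed

text \<open>Two monotonicities meet: events known at \<open>S\<close> are known at \<open>T\<close>,
  and controls reachable at \<open>T\<close> are reachable at \<open>S\<close>. The supremum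
  bounding the left side is thus over controls whose rewards the right side dominates.\<close>

lemma expectation_V_antimono:
  assumes lattice: "weak_upwards_lattice X"
    and c: "c \<in> controls X" and S: "S \<in> control_times X" and T: "T \<in> control_times X"
    and le: "precedes X c S T" and A: "A \<in> sets (info_at X c S)"
  shows "ereal_expectation (on_event (law X c) A) (V c T) \<le> ereal_expectation (on_event (law X c) A) (V c S)"
proof -
  have "A \<in> sets (info_at X c T)" using info_at_mono[OF c S T le] A by blast
  then have "ereal_expectation (on_event (law X c) A) (V c T)
    \<le> (SUP d\<in>reach X c T. ereal_expectation (on_event (law X d) A) (reward X d))"
    by (rule expectation_V_le_SUP[OF lattice c T])
  also have "\<dots> \<le> ereal_expectation (on_event (law X c) A) (V c S)"
    using reach_antimono[OF c S T le] by (intro SUP_least expectation_reward_le_V[OF c S _ A]) auto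
  finally show ?thesis .
qed

lemma cond_exp_V_le:
  assumes lattice: "weak_upwards_lattice X"
    and c: "c \<in> controls X" and S: "S \<in> control_times X" and T: "T \<in> control_times X"
    and le: "precedes X c S T"
  shows "AE \<omega> in law X c. ereal_cond_exp (law X c) (info_at X c S) (V c T) \<omega> \<le> V c S \<omega>"
proof -
  interpret finite_measure_subalgebra "law X c" "info_at X c S"
    by (rule finite_measure_subalgebra_info[OF c S])
  show ?thesis
  proof (rule AE_le_of_expectation_on_event_le[OF finite_measure_axioms subalg _ V_measurable[OF c S]])
    fix A assume A: "A \<in> sets (info_at X c S)"
    show "ereal_expectation (on_event (law X c) A) (ereal_cond_exp (law X c) (info_at X c S) (V c T))
      \<le> ereal_expectation (on_event (law X c) A) (V c S)"
      unfolding expectation_on_event_ereal_cond_exp[OF V_law_measurable[OF c T] A neg_integral_V[OF c T]]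
      by (rule expectation_V_antimono[OF lattice c S T le A])
  qed measurable
qed

text \<open>Both versions are essential suprema of the same family under the same restricted
  law.\<close>

lemma V_equiv_at:
  assumes S: "S \<in> control_times X" and c: "c \<in> controls X" and d: "d \<in> controls X" and eq: "equiv_at X S c d"
  shows "AE \<omega> in law X c. V c S \<omega> = V d S \<omega>"
    and "AE \<omega> in law X d. V c S \<omega> = V d S \<omega>"
proof -
  have reach: "reach X d S = reach X c S" by (rule equiv_at_reach_eq[OF S c d eq])
  then have dc: "d \<in> reach X c S" using reach_refl[OF d S] by simp
  have eq: "AE \<omega> in law_at X c S. V c S \<omega> = V d S \<omega>"
  proof (rule is_esssup_unique[OF bellman_esssup[OF c S]])
    show "is_esssup (law_at X c S) (reach X c S) (\<lambda>d. payoff X d S) (V d S)"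
      using bellman_esssup[OF d S] unfolding reach law_at_reach[OF c S dc] .
  qed
  show "AE \<omega> in law X c. V c S \<omega> = V d S \<omega>"
    by (rule AE_law_at[OF c S reach_refl[OF c S] eq])
  show "AE \<omega> in law X d. V c S \<omega> = V d S \<omega>"
    by (rule AE_law_at[OF c S dc eq])
qed

section \<open>Supermartingale property, martingale property and conditional optimality\<close>

lemma V_supermartingale_system:
  assumes "weak_upwards_lattice X"
  shows "supermartingale_system X V"
  unfolding supermartingale_system_def
proof (intro conjI ballI impI)
  fix c S d assume "c \<in> controls X" "S \<in> control_times X" "d \<in> controls X" "equiv_at X S c d"
  then show "AE \<omega> in law X c. V c S \<omega> = V d S \<omega>" "AE \<omega> in law X d. V c S \<omega> = V d S \<omega>"
    using V_equiv_at[of S c d] by auto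
next
  fix S T c assume "S \<in> control_times X" "T \<in> control_times X" "c \<in> controls X" "precedes X c S T"
  then show "AE \<omega> in law X c. ereal_cond_exp (law X c) (info_at X c S) (V c T) \<omega> \<le> V c S \<omega>"
    using cond_exp_V_le[OF assms, of c S T] by simp
qed (blast intro: V_measurable neg_integral_V)+

text \<open>The expectation is squeezed between the expected reward of \<open>c\<close> and the
  optimal value, which coincide.\<close>

lemma expectation_V_optimal:
  assumes "weak_upwards_lattice X" "c \<in> controls X" "optimal X c" "T \<in> control_times X"
  shows "ereal_expectation (law X c) (V c T) = optimal_value X"
  using expectation_V_le_optimal_value[OF assms(1,2,4)]
    expected_reward_le_V[OF assms(2,4) reach_refl[OF assms(2,4)]] assms(3)
  by (simp add: optimal_def)

lemma optimal_martingale: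
  assumes lattice: "weak_upwards_lattice X" and c: "c \<in> controls X" and opt: "optimal X c"
    and fin: "expected_reward X c < \<infinity>"
  shows "martingale_of X c (V c)"
  unfolding martingale_of_def
proof (intro conjI ballI impI)
  fix T assume T: "T \<in> control_times X"
  have E: "ereal_expectation (law X c) (V c T) = optimal_value X"
    by (rule expectation_V_optimal[OF lattice c opt T])
  show "V c T \<in> borel_measurable (info_at X c T)" by (rule V_measurable[OF c T])
  have [measurable]: "V c T \<in> borel_measurable (law X c)" by (rule V_law_measurable[OF c T])
  \<comment> \<open>The expectation of \<open>V c T\<close> is the finite expected reward of
    \<open>c\<close>, and its negative part is integrable, so its positive part is too.\<close>
  have "(\<integral>\<^sup>+ x. e2ennreal (V c T x) \<partial>law X c) < \<infinity>"
    using E fin opt neg_integral_V[OF c T] unfolding ereal_expectation_def optimal_def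
    by (cases "\<integral>\<^sup>+ x. e2ennreal (V c T x) \<partial>law X c"; cases "neg_integral (law X c) (V c T)") auto
  moreover have "e2ennreal \<bar>y\<bar> = e2ennreal y + e2ennreal (- y)" for y
    by (cases "0 \<le> y") (auto simp: e2ennreal_neg abs_ereal_ge0 abs_ereal_less0 not_le)
  then have "(\<integral>\<^sup>+ x. e2ennreal \<bar>V c T x\<bar> \<partial>law X c)
      = (\<integral>\<^sup>+ x. e2ennreal (V c T x) \<partial>law X c) + neg_integral (law X c) (V c T)"
    unfolding neg_integral_def by (simp add: nn_integral_add)
  ultimately show "ereal_integrable (law X c) (V c T)"
    using neg_integral_V[OF c T] by (simp add: ereal_integrable_def)
next
  fix S T assume S: "S \<in> control_times X" and T: "T \<in> control_times X" and le: "precedes X c S T"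
  interpret finite_measure_subalgebra "law X c" "info_at X c S"
    by (rule finite_measure_subalgebra_info[OF c S])
  have E: "ereal_expectation (law X c) (ereal_cond_exp (law X c) (info_at X c S) (V c T)) = optimal_value X"
    using expectation_V_optimal[OF lattice c opt T]
    by (simp add: ereal_expectation_cond_exp[OF V_law_measurable[OF c T] neg_integral_V[OF c T]])
  show "AE \<omega> in law X c. ereal_cond_exp (law X c) (info_at X c S) (V c T) \<omega> = V c S \<omega>"
  \<comment> \<open>The supermartingale inequality relates two functions whose expectations are both
    the optimal value, so it is an equality.\<close>
  proof (rule AE_eq_of_ereal_expectation_le[OF cond_exp_V_le[OF lattice c S T le] _ V_law_measurable[OF c S]])
    show "ereal_cond_exp (law X c) (info_at X c S) (V c T) \<in> borel_measurable (law X c)"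
      by (rule measurable_from_subalg[OF subalg]) measurable
    show "neg_integral (law X c) (ereal_cond_exp (law X c) (info_at X c S) (V c T)) < \<infinity>"
      using neg_integral_ereal_cond_exp_le[OF V_law_measurable[OF c T]] neg_integral_V[OF c T]
      by (rule le_less_trans)
  qed (use E fin opt expectation_V_optimal[OF lattice c opt S] in \<open>simp_all add: optimal_def\<close>)
qed

lemma conditionally_optimal_of_expectation_le:
  assumes c: "c \<in> controls X" and T: "T \<in> control_times X" and fin: "expected_reward X c < \<infinity>"
    and le: "ereal_expectation (law X c) (V c T) \<le> expected_reward X c"
  shows "conditionally_optimal X V c T"
proof -
  have "AE \<omega> in law X c. payoff X c T \<omega> = V c T \<omega>"
    by (rule AE_eq_of_ereal_expectation_le[OF payoff_le_V[OF c T reach_refl[OF c T]]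
          payoff_law_measurable[OF c T] V_law_measurable[OF c T] neg_integral_law_payoff[OF c T]])
      (use fin le in \<open>simp_all add: expectation_payoff_space[OF c T reach_refl[OF c T]]\<close>)
  then show ?thesis unfolding conditionally_optimal_def by eventually_elim simp
qed

text \<open>The expectation of \<open>V\<close> does not grow from \<open>S\<close> to
  \<open>T\<close>; at \<open>S\<close> conditional optimality makes it the expected reward, so at
  \<open>T\<close> it is at most that.\<close>

lemma conditionally_optimal_later:
  assumes lattice: "weak_upwards_lattice X"
    and c: "c \<in> controls X" and S: "S \<in> control_times X" and T: "T \<in> control_times X"
    and opt: "conditionally_optimal X V c S" and fin: "expected_reward X c < \<infinity>"
    and le: "precedes X c S T"
  shows "conditionally_optimal X V c T"
proof (rule conditionally_optimal_of_expectation_le[OF c T fin])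
  have "ereal_expectation (law X c) (V c T) \<le> ereal_expectation (law X c) (V c S)"
    using expectation_V_antimono[OF lattice c S T le space_in_info[OF c S]]
    unfolding ereal_expectation_on_space[OF V_law_measurable[OF c T]]
      ereal_expectation_on_space[OF V_law_measurable[OF c S]] .
  also have "\<dots> = ereal_expectation (law X c) (payoff X c S)"
    using opt unfolding conditionally_optimal_def by (rule ereal_expectation_cong_AE)
  also have "\<dots> = expected_reward X c" by (rule expectation_payoff_space[OF c S reach_refl[OF c S]])
  finally show "ereal_expectation (law X c) (V c T) \<le> expected_reward X c" .
qed

lemma optimal_conditionally_optimal:
  assumes lattice: "weak_upwards_lattice X" and c: "c \<in> controls X" and opt: "optimal X c"
    and fin: "expected_reward X c < \<infinity>" and T: "T \<in> control_times X"
  shows "conditionally_optimal X V c T"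
  using opt expectation_V_optimal[OF lattice c opt T]
  by (intro conditionally_optimal_of_expectation_le[OF c T fin]) (simp add: optimal_def)

text \<open>If the optimal value is infinite, equality of expectations is not enough, but triviality of the
  information at time \<open>0\<close> forces the payoff to be infinite almost surely.\<close>

lemma optimal_conditionally_optimal_zero:
  assumes lattice: "weak_upwards_lattice X" and c: "c \<in> controls X" and opt: "optimal X c"
    and Z: "Z \<in> control_times X" and zero: "surely X c (\<lambda>\<omega>. Z c \<omega> = 0)"
  shows "conditionally_optimal X V c Z"
proof (cases "expected_reward X c < \<infinity>")
  case True
  then show ?thesis by (rule optimal_conditionally_optimal[OF lattice c opt _ Z])
next
  case False
  have "AE \<omega> in law X c. payoff X c Z \<omega> = \<infinity>"
    using False expectation_payoff_space[OF c Z reach_refl[OF c Z]]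
    by (intro AE_infinite_of_trivial[OF prob_space_law[OF c] subalgebra_info[OF c Z]
          payoff_measurable[OF c Z reach_refl[OF c Z]] info_at_zero_trivial[OF c Z zero]]) auto
  \<comment> \<open>\<open>V c Z\<close> lies above an almost surely infinite payoff, hence is
    infinite as well.\<close>
  with payoff_le_V[OF c Z reach_refl[OF c Z]] show ?thesis
    unfolding conditionally_optimal_def by eventually_elim simp
qed

section \<open>From a limit at infinity back to optimality\<close>

text \<open>At time \<open>\<infinity>\<close> the class of \<open>c\<close> is a singleton, so the
  essential supremum reduces to the payoff of \<open>c\<close>.\<close>

lemma expectation_V_infinity:
  assumes c: "c \<in> controls X" and S: "S \<in> control_times X" and inf: "surely X c (\<lambda>\<omega>. S c \<omega> = \<infinity>)"
  shows "ereal_expectation (law X c) (V c S) = expected_reward X c"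
proof -
  have reach: "reach X c S = {c}" by (rule reach_infinity[OF c S inf])
  have "is_esssup (law_at X c S) {c} (\<lambda>d. payoff X d S) (payoff X c S)"
    using payoff_measurable[OF c S reach_refl[OF c S]]
    by (simp add: is_esssup_def measurable_law_at_iff[OF c S])
  then have "AE \<omega> in law_at X c S. V c S \<omega> = payoff X c S \<omega>"
    using bellman_esssup[OF c S] unfolding reach by (intro is_esssup_unique)
  then have "AE \<omega> in law X c. V c S \<omega> = payoff X c S \<omega>"
    by (rule AE_law_at[OF c S reach_refl[OF c S]])
  then show ?thesis
    using expectation_payoff_space[OF c S reach_refl[OF c S]] ereal_expectation_cong_AE by metis
qed

lemma optimal_of_uniformly_integrable:
  assumes c: "c \<in> controls X" and S: "\<And>n. S n \<in> control_times X"
    and zero: "surely X c (\<lambda>\<omega>. S 0 c \<omega> = 0)"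
    and const: "\<And>n. ereal_expectation (law X c) (V c (S n)) = e"
    and UI: "uniformly_integrable (law X c) UNIV (\<lambda>n. V c (S n))"
    and T: "T \<in> control_times X" and inf: "surely X c (\<lambda>\<omega>. T c \<omega> = \<infinity>)"
    and lim: "(AE \<omega> in law X c. (\<lambda>n. V c (S n) \<omega>) \<longlonglongrightarrow> V c T \<omega>) \<or>
      converges_in_probability (law X c) (\<lambda>n. V c (S n)) (V c T)"
  shows "optimal X c"
proof -
  obtain s :: "nat \<Rightarrow> nat" where s: "AE \<omega> in law X c. \<forall>r. V c T \<omega> < ereal r \<longrightarrow>
      (\<forall>\<^sub>F n in sequentially. V c (S (s n)) \<omega> < ereal r)"
    using lim
  proof
    assume "AE \<omega> in law X c. (\<lambda>n. V c (S n) \<omega>) \<longlonglongrightarrow> V c T \<omega>"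
    then have "AE \<omega> in law X c. \<forall>r. V c T \<omega> < ereal r \<longrightarrow> (\<forall>\<^sub>F n in sequentially. V c (S n) \<omega> < ereal r)"
      by eventually_elim (auto dest: order_tendstoD(2))
    \<comment> \<open>Under almost sure convergence the indices can be kept as they are.\<close>
    then show thesis by (rule that[of "\<lambda>n. n"])
  next
    assume "converges_in_probability (law X c) (\<lambda>n. V c (S n)) (V c T)"
    from converges_in_probability_subseq[OF prob_space_law[OF c] V_law_measurable[OF c S] V_law_measurable[OF c T] this]
    show thesis using that by blast
  qed
  have "optimal_value X \<le> e"
    \<comment> \<open>The constant \<open>e\<close> is read at index 0, where the class of
      \<open>c\<close> consists of all controls.\<close>
    unfolding optimal_value_def const[of 0, symmetric]
    using reach_zero[OF c S zero] by (intro SUP_least expected_reward_le_V[OF c S]) simp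
  also have "e \<le> ereal_expectation (law X c) (V c T)"
    by (rule expectation_limit_le[OF prob_space_law[OF c] UI const neg_integral_V[OF c S]
          V_law_measurable[OF c T] neg_integral_V[OF c T] s])
  also have "\<dots> = expected_reward X c" by (rule expectation_V_infinity[OF c T inf])
  finally have "optimal_value X \<le> expected_reward X c" .
  moreover have "expected_reward X c \<le> optimal_value X"
    unfolding optimal_value_def using c by (rule SUP_upper)
  ultimately show ?thesis unfolding optimal_def by (rule antisym[rotated])
qed

end

section \<open>Assembly of the claims\<close>

theorem theorem5p7:
  fixes X :: "('c, 'w) control_system"
    and V :: "'c \<Rightarrow> ('c \<Rightarrow> 'w \<Rightarrow> ennreal) \<Rightarrow> 'w \<Rightarrow> ereal"
    and zero_time infinity_time :: "'c \<Rightarrow> 'w \<Rightarrow> ennreal"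
  assumes "coherent_control_system X"
    and "bellman_system X V"
    and "zero_time \<in> control_times X" and "deterministic_time X 0 zero_time"
    and "infinity_time \<in> control_times X" and "deterministic_time X \<infinity> infinity_time"
  shows
    "(weak_upwards_lattice X \<longrightarrow>
        supermartingale_system X V \<and>
        (\<forall>c\<in>controls X. optimal X c \<longrightarrow>
           (\<forall>T\<in>control_times X. ereal_expectation (law X c) (V c T) = optimal_value X) \<and>
           optimal_value X = expected_reward X c) \<and>
        (\<forall>c\<in>controls X. optimal X c \<and> expected_reward X c < \<infinity> \<longrightarrow> martingale_of X c (V c)) \<and>
        (\<forall>c\<in>controls X. \<forall>S\<in>control_times X.
           conditionally_optimal X V c S \<and> expected_reward X c < \<infinity> \<longrightarrow>
           (\<forall>T\<in>control_times X. precedes X c S T \<longrightarrow> conditionally_optimal X V c T)) \<and>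
        (\<forall>c\<in>controls X. optimal X c \<longrightarrow> conditionally_optimal X V c zero_time) \<and>
        (\<forall>c\<in>controls X. optimal X c \<and> expected_reward X c < \<infinity> \<longrightarrow>
           (\<forall>S\<in>control_times X. conditionally_optimal X V c S)))
     \<and>
     (\<forall>c\<in>controls X. \<forall>S :: nat \<Rightarrow> 'c \<Rightarrow> 'w \<Rightarrow> ennreal.
        (\<forall>n. S n \<in> control_times X) \<and>
        deterministic_time X 0 (S 0) \<and>
        (\<exists>e. \<forall>n. ereal_expectation (law X c) (V c (S n)) = e) \<and>
        uniformly_integrable (law X c) UNIV (\<lambda>n. V c (S n)) \<and>
        ((AE \<omega> in law X c. (\<lambda>n. V c (S n) \<omega>) \<longlonglongrightarrow> V c infinity_time \<omega>) \<or>
         converges_in_probability (law X c) (\<lambda>n. V c (S n)) (V c infinity_time))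
        \<longrightarrow> optimal X c)"
proof -
  interpret coherent_bellman X V by unfold_locales fact+
  have zero: "surely X c (\<lambda>\<omega>. Z c \<omega> = 0)"
    if "deterministic_time X 0 Z" "c \<in> controls X" for Z :: "'c \<Rightarrow> 'w \<Rightarrow> ennreal" and c
    using that by (simp add: deterministic_time_def)
  have inf: "surely X c (\<lambda>\<omega>. infinity_time c \<omega> = \<infinity>)" if "c \<in> controls X" for c
    using assms(6) that by (simp add: deterministic_time_def)
  show ?thesis
  proof (intro conjI impI ballI allI; (elim conjE exE)?)
    show "optimal_value X = expected_reward X c" if "optimal X c" for c
      using that by (simp add: optimal_def)
    show "conditionally_optimal X V c T"
      if "weak_upwards_lattice X" "c \<in> controls X" "S \<in> control_times X" "T \<in> control_times X"
        "precedes X c S T" "conditionally_optimal X V c S" "expected_reward X c < \<infinity>" for c S T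
      using that by (intro conditionally_optimal_later[of c S T])
    show "optimal X c"
      if "c \<in> controls X" "\<forall>n. S n \<in> control_times X" "deterministic_time X 0 (S 0)"
        "uniformly_integrable (law X c) UNIV (\<lambda>n. V c (S n))"
        "(AE \<omega> in law X c. (\<lambda>n. V c (S n) \<omega>) \<longlonglongrightarrow> V c infinity_time \<omega>) \<or>
          converges_in_probability (law X c) (\<lambda>n. V c (S n)) (V c infinity_time)"
        "\<forall>n. ereal_expectation (law X c) (V c (S n)) = e" for c S e
      using that assms(5) zero inf by (intro optimal_of_uniformly_integrable[of c S e infinity_time]) auto
  qed (use V_supermartingale_system expectation_V_optimal optimal_martingale
      optimal_conditionally_optimal optimal_conditionally_optimal_zero[OF _ _ _ assms(3)] zero[OF assms(4)]
      in auto)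
qed

end
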